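(* Let $p$ be a prime and let $G$ be a finite VZ $p$-group such that $d(G')=d(Z(G))$. Then $$c(G)=|G/Z(G)|^{1/2}\,c(Z(G)).$$
   Context: All groups are finite. $d(G)$ denotes the minimal number of generators of $G$ and $G'$ the commutator subgroup. A VZ-group is a non-abelian group all of whose nonlinear irreducible complex characters vanish off the center (equivalently, its set of irreducible character degrees is $\{1,|G/Z(G)|^{1/2}\}$); a VZ $p$-group is a VZ-group that is a $p$-group. A quasi-permutation matrix is a square complex matrix whose trace is a non-negative integer; $c(G)$ is the minimal degree of a faithful representation of $G$ by complex quasi-permutation matrices. *)

theory Defs
  imports
    Complex_Main
    "HOL-Algebra.Generated_Groups"
    "HOL-Algebra.Coset"
    "Jordan_Normal_Form.VS_Connect"
begin

hide_const (open) Polynomial.order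

definition group_center :: "('a, 'b) monoid_scheme \<Rightarrow> 'a set" where
  "group_center G = {z \<in> carrier G. \<forall>g \<in> carrier G. z \<otimes>\<^bsub>G\<^esub> g = g \<otimes>\<^bsub>G\<^esub> z}"

abbreviation center_group :: "('a, 'b) monoid_scheme \<Rightarrow> ('a, 'b) monoid_scheme" where
  "center_group G \<equiv> G\<lparr>carrier := group_center G\<rparr>"

abbreviation commutator_group :: "('a, 'b) monoid_scheme \<Rightarrow> ('a, 'b) monoid_scheme" where
  "commutator_group G \<equiv> G\<lparr>carrier := derived G (carrier G)\<rparr>"

text \<open>The minimal number of generators; meaningful only for finitely generated groups.\<close>

definition min_generators :: "('a, 'b) monoid_scheme \<Rightarrow> nat" where
  "min_generators G =
     (LEAST k. \<exists>S. S \<subseteq> carrier G \<and> finite S \<and> card S = k \<and> generate G S = carrier G)"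

definition finite_p_group :: "nat \<Rightarrow> ('a, 'b) monoid_scheme \<Rightarrow> bool" where
  "finite_p_group p G \<longleftrightarrow> group G \<and> finite (carrier G) \<and> (\<exists>k. order G = p ^ k)"

definition trace_mat :: "'a :: comm_monoid_add mat \<Rightarrow> 'a" where
  "trace_mat A = (\<Sum>i<dim_row A. A $$ (i, i))"

text \<open>The unit argument of \<^const>\<open>ring_mat\<close> only fills the extension slot of the ring record.\<close>

definition GL_complex :: "nat \<Rightarrow> complex mat monoid" where
  "GL_complex n = units_of (ring_mat TYPE(complex) n ())"

text \<open>Representations have positive degree, so in particular the zero representation
  is not counted as a faithful representation of the trivial group.\<close>

definition complex_rep :: "('a, 'b) monoid_scheme \<Rightarrow> nat \<Rightarrow> ('a \<Rightarrow> complex mat) \<Rightarrow> bool" where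
  "complex_rep G n \<rho> \<longleftrightarrow> 0 < n \<and> \<rho> \<in> hom G (GL_complex n)"

definition faithful_rep :: "('a, 'b) monoid_scheme \<Rightarrow> nat \<Rightarrow> ('a \<Rightarrow> complex mat) \<Rightarrow> bool" where
  "faithful_rep G n \<rho> \<longleftrightarrow> complex_rep G n \<rho> \<and> inj_on \<rho> (carrier G)"

definition irreducible_rep :: "('a, 'b) monoid_scheme \<Rightarrow> nat \<Rightarrow> ('a \<Rightarrow> complex mat) \<Rightarrow> bool" where
  "irreducible_rep G n \<rho> \<longleftrightarrow> complex_rep G n \<rho> \<and>
     (\<forall>W. subspace class_ring W (module_vec TYPE(complex) n) \<and>
          (\<forall>g \<in> carrier G. \<forall>w \<in> W. \<rho> g *\<^sub>v w \<in> W) \<longrightarrow>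
          W = {0\<^sub>v n} \<or> W = carrier_vec n)"

text \<open>Only the values on the carrier are meaningful.\<close>

definition irreducible_character :: "('a, 'b) monoid_scheme \<Rightarrow> ('a \<Rightarrow> complex) \<Rightarrow> bool" where
  "irreducible_character G \<chi> \<longleftrightarrow>
     (\<exists>n \<rho>. irreducible_rep G n \<rho> \<and> (\<forall>g \<in> carrier G. \<chi> g = trace_mat (\<rho> g)))"

text \<open>The degree of a character is its value at the identity; it is linear if the degree is 1.\<close>

definition VZ_group :: "('a, 'b) monoid_scheme \<Rightarrow> bool" where
  "VZ_group G \<longleftrightarrow> group G \<and> finite (carrier G) \<and> \<not> comm_group G \<and>
     (\<forall>\<chi>. irreducible_character G \<chi> \<and> \<chi> \<one>\<^bsub>G\<^esub> \<noteq> 1 \<longrightarrow>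
        (\<forall>g \<in> carrier G - group_center G. \<chi> g = 0))"

definition quasi_permutation_mat :: "complex mat \<Rightarrow> bool" where
  "quasi_permutation_mat A \<longleftrightarrow> square_mat A \<and> trace_mat A \<in> \<nat>"

definition min_quasi_perm_degree :: "('a, 'b) monoid_scheme \<Rightarrow> nat" where
  "min_quasi_perm_degree G =
     (LEAST n. \<exists>\<rho>. faithful_rep G n \<rho> \<and> (\<forall>g \<in> carrier G. quasi_permutation_mat (\<rho> g)))"

end

theory Submission
  imports Defs "HOL-Algebra.Multiplicative_Group" "Jordan_Normal_Form.Spectral_Radius"
begin

text \<open>
  Let \<open>Z\<close> be the center and \<open>m\<^sup>2 = |G/Z|\<close>. Evaluating the regular character on \<open>G'\<close> gives \<open>G' \<le> Z\<close>,
  and the norm of an irreducible character that vanishes off \<open>Z\<close> gives degree \<open>m\<close>. So on \<open>Z\<close> every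
  character of \<open>G\<close> is \<open>m \<Lambda> + M\<close>, where \<open>\<Lambda>\<close> is a sum of linear characters of \<open>Z\<close> that are nontrivial on \<open>G'\<close>
  and the summands of \<open>M\<close> are trivial on \<open>G'\<close>; every character of \<open>Z\<close> is likewise \<open>\<Lambda> + M\<close>.
  The hypothesis \<open>d(G') = d(Z)\<close> says that \<open>G'\<close> contains all elements of order \<open>p\<close> of \<open>Z\<close>, so \<open>\<Lambda>\<close> alone
  is faithful. For a character with natural number values \<open>\<Lambda>\<close> is integer-valued,
  and \<open>|M(z)| \<le> M(1)\<close> bounds it from below. Hence in either direction one may
  exchange \<open>\<Lambda>\<close> and \<open>m \<Lambda>\<close> (lifting each linear character of \<open>Z\<close> to the irreducible
  character of \<open>G\<close> of degree \<open>m\<close> above it) and replace \<open>M\<close> by a multiple of the trivial character.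
\<close>

hide_const (open) Polynomial.order

section \<open>Matrix representations\<close>

text \<open>Exchanging characters can make a trace negative; the trivial summands repair this, and
  their number is what has to be controlled. From \<open>Z\<close> to \<open>G\<close> the lower
  bound scales by m, so m times as many suffice. From \<open>G\<close> to \<open>Z\<close> it is
  divided by m, and the degree count only leaves room for the integer quotient of the number of
  summands of M by m. This is enough because \<Lambda>(z) is an integer, which is why rational
  values have to be upgraded to integers. Complete reducibility is bypassed: composition factors
  already determine the character, and an element acting trivially on all of them acts by a
  unipotent matrix of finite order, hence trivially. Generator numbers meet elements of order p by
  counting: an abelian p-group \<open>A\<close> has exactly p^d(A) solutions of x^p = 1. Equal d
  thus gives G' and \<open>Z\<close> the same solutions, and every nontrivial element of
  \<open>Z\<close> has a nontrivial power among them.\<close>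

lemma complex_rep_iff:
  assumes "group H"
  shows "complex_rep H n \<rho> \<longleftrightarrow> 0 < n \<and> (\<forall>g\<in>carrier H. \<rho> g \<in> carrier_mat n n) \<and>
    \<rho> \<one>\<^bsub>H\<^esub> = 1\<^sub>m n \<and> (\<forall>g\<in>carrier H. \<forall>h\<in>carrier H. \<rho> (g \<otimes>\<^bsub>H\<^esub> h) = \<rho> g * \<rho> h)"
proof -
  interpret group H by fact
  let ?R = "ring_mat TYPE(complex) n ()"
  interpret R: ring ?R by (rule ring_mat)
  interpret U: group "units_of ?R" by (rule R.units_group)
  have U: "carrier (GL_complex n) = Units ?R" "monoid.mult (GL_complex n) = (*)" "one (GL_complex n) = 1\<^sub>m n"
    by (simp_all add: GL_complex_def units_of_def ring_mat_simps)
  have UI: "X \<in> Units ?R" if "X \<in> carrier_mat n n" "Y \<in> carrier_mat n n" "X * Y = 1\<^sub>m n" "Y * X = 1\<^sub>m n" for X Y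
    using that unfolding Units_def by (auto simp: ring_mat_simps)
  show ?thesis
  proof
    assume rep: "complex_rep H n \<rho>"
    then have hom: "\<rho> \<in> hom H (units_of ?R)" and n: "0 < n"
      by (auto simp: complex_rep_def GL_complex_def)
    interpret group_hom H "units_of ?R" \<rho>
      using hom by unfold_locales
    have "\<rho> \<one>\<^bsub>H\<^esub> = 1\<^sub>m n" using hom_one by (simp add: units_of_def ring_mat_simps)
    moreover have "\<rho> g \<in> carrier_mat n n" if "g \<in> carrier H" for g
      using hom_closed[OF that] by (auto simp: units_of_def Units_def ring_mat_simps)
    moreover have "\<rho> (g \<otimes>\<^bsub>H\<^esub> h) = \<rho> g * \<rho> h" if "g \<in> carrier H" "h \<in> carrier H" for g h
      using hom_mult[OF that] by (simp add: units_of_def ring_mat_simps)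
    ultimately show "0 < n \<and> (\<forall>g\<in>carrier H. \<rho> g \<in> carrier_mat n n) \<and>
      \<rho> \<one>\<^bsub>H\<^esub> = 1\<^sub>m n \<and> (\<forall>g\<in>carrier H. \<forall>h\<in>carrier H. \<rho> (g \<otimes>\<^bsub>H\<^esub> h) = \<rho> g * \<rho> h)"
      using n by blast
  next
    assume r: "0 < n \<and> (\<forall>g\<in>carrier H. \<rho> g \<in> carrier_mat n n) \<and>
      \<rho> \<one>\<^bsub>H\<^esub> = 1\<^sub>m n \<and> (\<forall>g\<in>carrier H. \<forall>h\<in>carrier H. \<rho> (g \<otimes>\<^bsub>H\<^esub> h) = \<rho> g * \<rho> h)"
    \<comment> \<open>The matrix equations force invertibility: the image of the inverse element is
      a two-sided inverse.\<close>
    have "\<rho> g \<in> Units ?R" if g: "g \<in> carrier H" for g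
    proof (rule UI[of _ "\<rho> (inv\<^bsub>H\<^esub> g)"])
      show "\<rho> g * \<rho> (inv\<^bsub>H\<^esub> g) = 1\<^sub>m n" "\<rho> (inv\<^bsub>H\<^esub> g) * \<rho> g = 1\<^sub>m n"
        using r g by (metis inv_closed r_inv, metis inv_closed l_inv)
    qed (use r g in auto)
    then show "complex_rep H n \<rho>"
      using r unfolding complex_rep_def hom_def U by auto
  qed
qed

lemma complex_repD:
  assumes "group H" "complex_rep H n \<rho>"
  shows "0 < n" "g \<in> carrier H \<Longrightarrow> \<rho> g \<in> carrier_mat n n" "\<rho> \<one>\<^bsub>H\<^esub> = 1\<^sub>m n"
    "g \<in> carrier H \<Longrightarrow> h \<in> carrier H \<Longrightarrow> \<rho> (g \<otimes>\<^bsub>H\<^esub> h) = \<rho> g * \<rho> h"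
  using assms(2) unfolding complex_rep_iff[OF assms(1)] by auto

lemma complex_rep_pow:
  assumes "group H" "complex_rep H n \<rho>" "g \<in> carrier H"
  shows "\<rho> (g [^]\<^bsub>H\<^esub> (k::nat)) = \<rho> g ^\<^sub>m k"
proof -
  interpret group H by fact
  have d: "dim_row (\<rho> g) = n" using complex_repD(2)[OF assms] by simp
  show ?thesis
    using complex_repD[OF assms(1,2)] assms(3) by (induction k) (auto simp: d)
qed

lemma complex_rep_inv:
  assumes "group H" "complex_rep H n \<rho>" "g \<in> carrier H"
  shows "\<rho> g * \<rho> (inv\<^bsub>H\<^esub> g) = 1\<^sub>m n" "\<rho> (inv\<^bsub>H\<^esub> g) * \<rho> g = 1\<^sub>m n"
proof -
  interpret group H by fact
  show "\<rho> g * \<rho> (inv\<^bsub>H\<^esub> g) = 1\<^sub>m n" "\<rho> (inv\<^bsub>H\<^esub> g) * \<rho> g = 1\<^sub>m n"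
    using complex_repD[OF assms(1,2)] assms(3) by (metis inv_closed r_inv, metis inv_closed l_inv)
qed

section \<open>Traces of products and of block matrices\<close>

lemma trace_mat_comm:
  assumes "X \<in> carrier_mat n m" "Y \<in> carrier_mat m n"
  shows "trace_mat (X * Y) = trace_mat (Y * X :: 'a :: comm_ring_1 mat)"
proof -
  have "trace_mat (X * Y) = (\<Sum>i<n. \<Sum>j<m. X $$ (i,j) * Y $$ (j,i))"
    using assms by (auto simp: trace_mat_def scalar_prod_def lessThan_atLeast0 intro!: sum.cong)
  also have "\<dots> = (\<Sum>j<m. \<Sum>i<n. Y $$ (j,i) * X $$ (i,j))"
    by (subst sum.swap) (simp add: mult.commute)
  also have "\<dots> = trace_mat (Y * X)"
    using assms by (auto simp: trace_mat_def scalar_prod_def lessThan_atLeast0 intro!: sum.cong)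
  finally show ?thesis .
qed

lemma trace_four_block:
  assumes "X \<in> carrier_mat n n" "Y \<in> carrier_mat m m"
  shows "trace_mat (four_block_mat X B C Y) = trace_mat X + (trace_mat Y :: 'a :: comm_ring_1)"
proof -
  have "trace_mat (four_block_mat X B C Y) = (\<Sum>i<n+m. if i < n then X $$ (i,i) else Y $$ (i-n,i-n))"
    using assms by (auto simp: trace_mat_def intro!: sum.cong)
  also have "\<dots> = (\<Sum>i<n. X $$ (i,i)) + (\<Sum>i<m. Y $$ (i,i))"
    by (induction m) auto
  finally show ?thesis using assms by (simp add: trace_mat_def)
qed

lemma trace_smult_one: "trace_mat (c \<cdot>\<^sub>m 1\<^sub>m n) = of_nat n * (c :: 'a :: comm_ring_1)"
  by (simp add: trace_mat_def)

lemma trace_one: "trace_mat (1\<^sub>m n :: 'a :: comm_ring_1 mat) = of_nat n"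
  by (simp add: trace_mat_def)

section \<open>Invariant subspaces, Schur's lemma and composition factors\<close>

lemma subspace_vecI:
  assumes "W \<subseteq> carrier_vec n" "0\<^sub>v n \<in> W" "\<And>v w. v \<in> W \<Longrightarrow> w \<in> W \<Longrightarrow> v + w \<in> W"
    "\<And>c v. v \<in> W \<Longrightarrow> c \<cdot>\<^sub>v v \<in> W"
  shows "VectorSpace.subspace class_ring W (module_vec TYPE(complex) n)"
  unfolding VectorSpace.subspace_def submodule_def
  using assms by (auto simp: vec_vs vec_module module_vec_simps)

lemma subspace_vecD:
  assumes "VectorSpace.subspace class_ring W (module_vec TYPE(complex) n)"
  shows "W \<subseteq> carrier_vec n" "0\<^sub>v n \<in> W" "\<And>v w. v \<in> W \<Longrightarrow> w \<in> W \<Longrightarrow> v + w \<in> W"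
    "\<And>c v. v \<in> W \<Longrightarrow> c \<cdot>\<^sub>v v \<in> W"
  using assms unfolding VectorSpace.subspace_def submodule_def
  by (auto simp: module_vec_simps)

lemma irreducible_repD:
  assumes "irreducible_rep H n \<rho>" "W \<subseteq> carrier_vec n" "0\<^sub>v n \<in> W"
    "\<And>v w. v \<in> W \<Longrightarrow> w \<in> W \<Longrightarrow> v + w \<in> W" "\<And>c v. v \<in> W \<Longrightarrow> c \<cdot>\<^sub>v v \<in> W"
    "\<And>g w. g \<in> carrier H \<Longrightarrow> w \<in> W \<Longrightarrow> \<rho> g *\<^sub>v w \<in> W"
  shows "W = {0\<^sub>v n} \<or> W = carrier_vec n"
  using assms(1,6) subspace_vecI[OF assms(2-5)] unfolding irreducible_rep_def by blast

text \<open>Over the complex numbers \<open>T\<close> has an eigenvector, and the eigenspace is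
  invariant because \<open>T\<close> commutes with the representation. Irreducibility makes it the
  whole space.\<close>

theorem schur_scalar:
  assumes H: "group H" and irr: "irreducible_rep H n \<rho>" and T: "T \<in> carrier_mat n n"
    and comm: "\<And>g. g \<in> carrier H \<Longrightarrow> T * \<rho> g = \<rho> g * T"
  obtains c where "T = c \<cdot>\<^sub>m 1\<^sub>m n"
proof -
  have rep: "complex_rep H n \<rho>" using irr by (simp add: irreducible_rep_def)
  note R = complex_repD[OF H rep]
  obtain c v where v: "eigenvector T v c"
    using spectrum_non_empty[OF T R(1)] unfolding spectrum_def eigenvalue_def by auto
  define W where "W = {w \<in> carrier_vec n. T *\<^sub>v w = c \<cdot>\<^sub>v w}"
  have "W = {0\<^sub>v n} \<or> W = carrier_vec n"
  proof (rule irreducible_repD[OF irr])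
    fix g w assume g: "g \<in> carrier H" and w: "w \<in> W"
    have "T *\<^sub>v (\<rho> g *\<^sub>v w) = (T * \<rho> g) *\<^sub>v w"
      using R(2)[OF g] T w by (simp add: W_def assoc_mult_mat_vec[of _ n n _ n])
    also have "\<dots> = \<rho> g *\<^sub>v (T *\<^sub>v w)"
      using R(2)[OF g] T w by (simp add: W_def comm[OF g] assoc_mult_mat_vec[of _ n n _ n])
    also have "\<dots> = c \<cdot>\<^sub>v (\<rho> g *\<^sub>v w)"
      using R(2)[OF g] w by (simp add: W_def mult_mat_vec[of _ n n])
    finally show "\<rho> g *\<^sub>v w \<in> W" using R(2)[OF g] w by (auto simp: W_def)
  qed (use T in \<open>auto simp: W_def mult_add_distrib_mat_vec[of _ n n] smult_add_distrib_vec
        mult_mat_vec[of _ n n] smult_smult_assoc mult.commute\<close>)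
  moreover have "v \<in> W" "v \<noteq> 0\<^sub>v n" using v T by (auto simp: W_def eigenvector_def)
  ultimately have W: "W = carrier_vec n" by blast
  have "T = c \<cdot>\<^sub>m 1\<^sub>m n"
  proof (rule eq_matI)
    fix i j assume ij: "i < dim_row (c \<cdot>\<^sub>m 1\<^sub>m n)" "j < dim_col (c \<cdot>\<^sub>m 1\<^sub>m n)"
    have "T *\<^sub>v unit_vec n j = c \<cdot>\<^sub>v unit_vec n j" using W unit_vec_carrier[of n j] unfolding W_def by blast
    from arg_cong[OF this, of "\<lambda>v. v $ i"] show "T $$ (i,j) = (c \<cdot>\<^sub>m 1\<^sub>m n) $$ (i,j)"
      using ij T by (auto simp: scalar_prod_right_unit[of _ n])
  qed (use T in auto)
  then show ?thesis by (rule that)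
qed

text \<open>Scalar matrices preserve every subspace. The hyperplane of vectors with first coordinate
  0 is proper, and it is nonzero as soon as n > 1.\<close>

lemma irreducible_rep_scalars_degree_1:
  assumes irr: "irreducible_rep H n \<rho>" and n: "0 < n"
    and sc: "\<And>g. g \<in> carrier H \<Longrightarrow> \<exists>c. \<rho> g = c \<cdot>\<^sub>m 1\<^sub>m n"
  shows "n = 1"
proof (rule ccontr)
  assume "n \<noteq> 1"
  with n have n1: "1 < n" by simp
  define W where "W = {w \<in> carrier_vec n. w $ 0 = (0::complex)}"
  have "W = {0\<^sub>v n} \<or> W = carrier_vec n"
  proof (rule irreducible_repD[OF irr])
    fix g w assume "g \<in> carrier H" "w \<in> W"
    then obtain c where c: "\<rho> g = c \<cdot>\<^sub>m 1\<^sub>m n" using sc by blast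
    have "(c \<cdot>\<^sub>m 1\<^sub>m n) *\<^sub>v w = c \<cdot>\<^sub>v w" using \<open>w \<in> W\<close>
      by (intro eq_vecI) (auto simp: W_def)
    then show "\<rho> g *\<^sub>v w \<in> W" using \<open>w \<in> W\<close> n by (auto simp: c W_def)
  qed (use n in \<open>auto simp: W_def\<close>)
  moreover have "unit_vec n 1 \<in> W" "unit_vec n 1 \<noteq> (0\<^sub>v n :: complex vec)" "unit_vec n 0 \<notin> W"
    using n1 by (auto simp: W_def)
  ultimately show False by auto
qed

text \<open>A basis of \<open>W\<close> extended to the whole space, in matrix form and without
  dimension theory: \<open>d\<close> is the largest number of leading columns in \<open>W\<close>
  that an invertible matrix can have. The last conclusion says that the first \<open>d\<close>
  columns span \<open>W\<close>, expressed by coordinates.\<close>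

lemma subspace_vec_adapted_basis:
  assumes W: "VectorSpace.subspace class_ring W (module_vec TYPE(complex) n)"
  obtains P d where "P \<in> carrier_mat n n" "det P \<noteq> 0" "d \<le> n" "\<And>j. j < d \<Longrightarrow> col P j \<in> W"
    "\<And>a i. a \<in> carrier_vec n \<Longrightarrow> P *\<^sub>v a \<in> W \<Longrightarrow> d \<le> i \<Longrightarrow> i < n \<Longrightarrow> a $ i = 0"
proof -
  define ok where "ok = (\<lambda>d. d \<le> n \<and> (\<exists>P \<in> carrier_mat n n. det P \<noteq> 0 \<and> (\<forall>j<d. col P j \<in> W)))"
  have ok0: "ok 0" unfolding ok_def by (intro conjI bexI[of _ "1\<^sub>m n"]) auto
  define d where "d = (GREATEST d. ok d)"
  have bound: "ok e \<Longrightarrow> e \<le> n" for e by (simp add: ok_def)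
  have "ok d" unfolding d_def by (rule GreatestI_nat[of ok 0 n]) (use ok0 bound in auto)
  have max: "e \<le> d" if "ok e" for e
    unfolding d_def by (rule Greatest_le_nat[of ok e n]) (use that bound in auto)
  from \<open>ok d\<close> obtain P where P: "P \<in> carrier_mat n n" "det P \<noteq> 0" "\<And>j. j < d \<Longrightarrow> col P j \<in> W"
    and d: "d \<le> n" by (auto simp: ok_def)
  have "a $ i = 0" if a: "a \<in> carrier_vec n" "P *\<^sub>v a \<in> W" "d \<le> i" "i < n" for a i
  proof (rule ccontr)
    assume ai: "a $ i \<noteq> 0"
    \<comment> \<open>By Cramer's rule the determinant of \<open>Q\<close> is \<open>a $ i\<close>
      times that of \<open>P\<close>, so \<open>Q\<close> is still invertible but has one more
      column in \<open>W\<close>.\<close>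
    define Q where "Q = replace_col P (P *\<^sub>v a) i"
    have Q: "Q \<in> carrier_mat n n" using P by (auto simp: Q_def replace_col_def)
    have detQ: "det Q \<noteq> 0"
      using cramer_lemma_mat[OF P(1) a(1,4)] P(2) ai by (simp add: Q_def)
    have Qj: "col Q j \<in> W" if "j < d" for j
    proof -
      have "col Q j = col P j" using that a d P(1)
        by (intro eq_vecI) (auto simp: Q_def replace_col_def)
      then show ?thesis using P(3)[OF that] by simp
    qed
    have Qi: "col Q i = P *\<^sub>v a" using a P(1)
      by (intro eq_vecI) (auto simp: Q_def replace_col_def)
    \<comment> \<open>Moving the new column to position \<open>d\<close> makes the first
      \<open>d + 1\<close> columns lie in \<open>W\<close>, against maximality. The columns before
      \<open>d\<close> are untouched because \<open>d \<le> i\<close>.\<close>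
    define S where "S = (if i = d then Q else swapcols d i Q)"
    have S: "S \<in> carrier_mat n n" using Q by (auto simp: S_def)
    have "det S \<noteq> 0" using detQ det_swapcols[OF _ a(4) _ Q, of d] a(3,4) by (auto simp: S_def)
    moreover have "col S j \<in> W" if "j < Suc d" for j
    proof (cases "j = d")
      case True
      have "col S j = col Q i" using True a Q
        by (intro eq_vecI) (auto simp: S_def)
      then show ?thesis using Qi a by simp
    next
      case False
      have "col S j = col Q j" using False that a Q
        by (intro eq_vecI) (auto simp: S_def)
      then show ?thesis using Qj False that by simp
    qed
    ultimately have "ok (Suc d)" using a S by (auto simp: ok_def)
    then show False using max by fastforce
  qed
  with that P d show thesis by blast
qed

text \<open>The product is a linear combination of the columns; the induction runs over the
  truncations of \<open>a\<close> to its first \<open>k\<close> coordinates.\<close>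

lemma mult_mat_vec_in_subspace:
  assumes W: "VectorSpace.subspace class_ring W (module_vec TYPE(complex) n)"
    and P: "P \<in> carrier_mat n n" "\<And>j. j < n \<Longrightarrow> col P j \<in> W" and a: "a \<in> carrier_vec n"
  shows "P *\<^sub>v a \<in> W"
proof -
  note S = subspace_vecD[OF W]
  have "P *\<^sub>v vec n (\<lambda>i. if i < k then a $ i else 0) \<in> W" if "k \<le> n" for k
    using that
  proof (induction k)
    case 0
    have "P *\<^sub>v vec n (\<lambda>i. 0) = 0\<^sub>v n" using P(1) by (intro eq_vecI) (auto simp: scalar_prod_def)
    then show ?case using S(2) by simp
  next
    case (Suc k)
    have "vec n (\<lambda>i. if i < Suc k then a $ i else 0) =
      vec n (\<lambda>i. if i < k then a $ i else 0) + a $ k \<cdot>\<^sub>v unit_vec n k"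
      by (intro eq_vecI) (auto simp: less_Suc_eq unit_vec_def)
    moreover have "P *\<^sub>v unit_vec n k = col P k"
      using P(1) Suc.prems by (intro eq_vecI) (auto simp: scalar_prod_right_unit[of _ n])
    ultimately have "P *\<^sub>v vec n (\<lambda>i. if i < Suc k then a $ i else 0) =
      P *\<^sub>v vec n (\<lambda>i. if i < k then a $ i else 0) + a $ k \<cdot>\<^sub>v col P k"
      using P(1) by (simp add: mult_add_distrib_mat_vec[of _ n n] mult_mat_vec[of _ n n])
    then show ?case using Suc P(2)[of k] S(3,4) by auto
  qed
  moreover have "vec n (\<lambda>i. if i < n then a $ i else 0) = a"
    using a by (intro eq_vecI) auto
  ultimately show ?thesis by force
qed

lemma complex_rep_conj:
  assumes H: "group H" and rep: "complex_rep H n \<rho>"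
    and PQ: "P \<in> carrier_mat n n" "Q \<in> carrier_mat n n" "P * Q = 1\<^sub>m n" "Q * P = 1\<^sub>m n"
  shows "complex_rep H n (\<lambda>g. Q * \<rho> g * P)"
proof -
  note R = complex_repD[OF H rep]
  have "Q * (\<rho> g * \<rho> h) * P = Q * \<rho> g * P * (Q * \<rho> h * P)"
    if gh: "g \<in> carrier H" "h \<in> carrier H" for g h
  proof -
    have "P * (Q * M) = M" if "M \<in> carrier_mat n n" for M :: "complex mat"
      using PQ that by (metis assoc_mult_mat left_mult_one_mat)
    then show ?thesis
      using R(2)[OF gh(1)] R(2)[OF gh(2)] PQ(1,2)
      by (simp add: assoc_mult_mat[of _ n n _ n _ n] mult_carrier_mat[of _ n n _ n])
  qed
  then show ?thesis
    unfolding complex_rep_iff[OF H] using R PQ by auto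
qed

text \<open>In a basis adapted to a proper nonzero invariant subspace the lower left block vanishes.
  The two diagonal blocks are the representations on the subspace and on the quotient. No invariant
  complement is chosen, so \<open>B\<close> stays arbitrary.\<close>

lemma reducible_rep_block:
  assumes H: "group H" and rep: "complex_rep H n \<rho>" and red: "\<not> irreducible_rep H n \<rho>"
  obtains P Q d e X B Y where "P \<in> carrier_mat n n" "Q \<in> carrier_mat n n" "P * Q = 1\<^sub>m n" "Q * P = 1\<^sub>m n"
    "n = d + e" "complex_rep H d X" "complex_rep H e Y" "\<And>g. g \<in> carrier H \<Longrightarrow> B g \<in> carrier_mat d e"
    "\<And>g. g \<in> carrier H \<Longrightarrow> Q * \<rho> g * P = four_block_mat (X g) (B g) (0\<^sub>m e d) (Y g)"
proof -
  note R = complex_repD[OF H rep]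
  interpret group H by fact
  from red rep obtain W where W: "VectorSpace.subspace class_ring W (module_vec TYPE(complex) n)"
    and inv: "\<And>g w. g \<in> carrier H \<Longrightarrow> w \<in> W \<Longrightarrow> \<rho> g *\<^sub>v w \<in> W"
    and ne: "W \<noteq> {0\<^sub>v n}" "W \<noteq> carrier_vec n"
    unfolding irreducible_rep_def by blast
  note S = subspace_vecD[OF W]
  obtain P d where P: "P \<in> carrier_mat n n" "det P \<noteq> 0" and d: "d \<le> n"
    and Pc: "\<And>j. j < d \<Longrightarrow> col P j \<in> W"
    and Pz: "\<And>a i. a \<in> carrier_vec n \<Longrightarrow> P *\<^sub>v a \<in> W \<Longrightarrow> d \<le> i \<Longrightarrow> i < n \<Longrightarrow> a $ i = 0"
    using subspace_vec_adapted_basis[OF W] by metis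
  from det_non_zero_imp_unit[OF P, of "()"] obtain Q where Q: "Q \<in> carrier_mat n n" "P * Q = 1\<^sub>m n" "Q * P = 1\<^sub>m n"
    unfolding Units_def by (auto simp: ring_mat_simps)
  have PQv: "P *\<^sub>v (Q *\<^sub>v w) = w" if "w \<in> carrier_vec n" for w
    using P(1) Q that by (metis assoc_mult_mat_vec one_mult_mat_vec)
  \<comment> \<open>Both diagonal blocks must have positive degree. With \<open>d = n\<close> all
    columns of the invertible \<open>P\<close> would lie in \<open>W\<close>; with
    \<open>d = 0\<close> every vector of \<open>W\<close> would have zero coordinates.\<close>
  have "d \<noteq> n"
  proof
    assume "d = n"
    have "carrier_vec n \<subseteq> W"
    proof
      fix w :: "complex vec" assume w: "w \<in> carrier_vec n"
      have "P *\<^sub>v (Q *\<^sub>v w) \<in> W"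
        by (rule mult_mat_vec_in_subspace[OF W P(1)]) (use Pc Q w \<open>d = n\<close> in auto)
      then show "w \<in> W" using PQv w by simp
    qed
    then show False using ne S(1) by blast
  qed
  have "d \<noteq> 0"
  proof
    assume d0: "d = 0"
    have "w = 0\<^sub>v n" if w: "w \<in> W" for w
    proof -
      have wc: "w \<in> carrier_vec n" using S(1) w by blast
      have "Q *\<^sub>v w = 0\<^sub>v n"
        using Pz[of "Q *\<^sub>v w"] PQv[OF wc] w Q(1) wc d0 by (intro eq_vecI) auto
      then have "w = P *\<^sub>v 0\<^sub>v n" using PQv[OF wc] by simp
      then show ?thesis using P(1) by (auto intro!: eq_vecI simp: scalar_prod_def)
    qed
    then show False using ne S(2) by blast
  qed
  define e where "e = n - d"
  have n: "n = d + e" "0 < d" "0 < e" using d \<open>d \<noteq> n\<close> \<open>d \<noteq> 0\<close> by (auto simp: e_def)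
  define \<sigma> where "\<sigma> g = Q * \<rho> g * P" for g
  have \<sigma>: "complex_rep H n \<sigma>" unfolding \<sigma>_def by (rule complex_rep_conj[OF H rep P(1) Q(1,2,3)])
  note RS = complex_repD[OF H \<sigma>]
  define X where "X g = mat d d (\<lambda>ij. \<sigma> g $$ ij)" for g
  define B where "B g = mat d e (\<lambda>(i,j). \<sigma> g $$ (i,j+d))" for g
  define Y where "Y g = mat e e (\<lambda>(i,j). \<sigma> g $$ (i+d,j+d))" for g
  have c: "X g \<in> carrier_mat d d" "B g \<in> carrier_mat d e" "Y g \<in> carrier_mat e e" for g
    by (auto simp: X_def B_def Y_def)
  \<comment> \<open>Column \<open>j\<close> of \<open>\<sigma> g\<close> holds the
    \<open>P\<close>-coordinates of the image of \<open>col P j\<close>. That image stays in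
    \<open>W\<close>, so its coordinates from \<open>d\<close> on are 0.\<close>
  have low: "\<sigma> g $$ (i,j) = 0" if g: "g \<in> carrier H" and ij: "d \<le> i" "i < n" "j < d" for g i j
  proof -
    have cw: "\<rho> g *\<^sub>v col P j \<in> W" using inv[OF g] Pc ij by simp
    have cc: "\<rho> g *\<^sub>v col P j \<in> carrier_vec n" using cw S(1) by blast
    have "col (\<sigma> g) j = Q *\<^sub>v (\<rho> g *\<^sub>v col P j)"
    proof -
      have "\<sigma> g = Q * (\<rho> g * P)" unfolding \<sigma>_def using P Q R(2)[OF g] by (simp add: assoc_mult_mat)
      moreover have "j < n" using ij n by simp
      ultimately show ?thesis
        using col_mult2[OF Q(1), of "\<rho> g * P" n j] col_mult2[OF R(2)[OF g] P(1)] P(1) R(2)[OF g]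
        by (metis mult_carrier_mat)
    qed
    moreover have "(Q *\<^sub>v (\<rho> g *\<^sub>v col P j)) $ i = 0"
      by (rule Pz) (use Q cc cw PQv[OF cc] ij in auto)
    ultimately show ?thesis using ij RS(2)[OF g] n by (metis index_col carrier_matD trans_less_add1)
  qed
  have blk: "\<sigma> g = four_block_mat (X g) (B g) (0\<^sub>m e d) (Y g)" if g: "g \<in> carrier H" for g
    using RS(2)[OF g] n low[OF g] by (intro eq_matI) (auto simp: X_def B_def Y_def)
  have mult: "X (g \<otimes>\<^bsub>H\<^esub> h) = X g * X h \<and> Y (g \<otimes>\<^bsub>H\<^esub> h) = Y g * Y h"
    if gh: "g \<in> carrier H" "h \<in> carrier H" for g h
  proof -
    have "\<sigma> (g \<otimes>\<^bsub>H\<^esub> h) = four_block_mat (X g * X h) (X g * B h + B g * Y h) (0\<^sub>m e d) (Y g * Y h)"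
      unfolding RS(4)[OF gh] blk[OF gh(1)] blk[OF gh(2)]
      by (subst mult_four_block_mat[of _ d d _ e _ e _ _ d _ e])
        (use c[of g] c[of h] in \<open>auto simp: left_add_zero_mat[of _ d d]\<close>)
    then have E: "four_block_mat (X (g \<otimes>\<^bsub>H\<^esub> h)) (B (g \<otimes>\<^bsub>H\<^esub> h)) (0\<^sub>m e d) (Y (g \<otimes>\<^bsub>H\<^esub> h))
       = four_block_mat (X g * X h) (X g * B h + B g * Y h) (0\<^sub>m e d) (Y g * Y h)"
      using blk gh by simp
    have "X (g \<otimes>\<^bsub>H\<^esub> h) $$ (i,j) = (X g * X h) $$ (i,j)" if "i < d" "j < d" for i j
      using arg_cong[OF E, of "\<lambda>M. M $$ (i,j)"] that c[of g] c[of h] c[of "g \<otimes>\<^bsub>H\<^esub> h"] by simp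
    moreover have "Y (g \<otimes>\<^bsub>H\<^esub> h) $$ (i,j) = (Y g * Y h) $$ (i,j)" if "i < e" "j < e" for i j
      using arg_cong[OF E, of "\<lambda>M. M $$ (i+d,j+d)"] that c[of g] c[of h] c[of "g \<otimes>\<^bsub>H\<^esub> h"] by simp
    ultimately show ?thesis using c[of g] c[of h] c[of "g \<otimes>\<^bsub>H\<^esub> h"]
      by (intro conjI eq_matI) auto
  qed
  have one: "X \<one>\<^bsub>H\<^esub> = 1\<^sub>m d" "Y \<one>\<^bsub>H\<^esub> = 1\<^sub>m e"
    using RS(3) n by (auto simp: X_def Y_def intro!: eq_matI)
  have XY: "complex_rep H d X" "complex_rep H e Y"
    unfolding complex_rep_iff[OF H] using mult one n c by auto
  show thesis by (rule that[OF P(1) Q n(1) XY c(2)]) (use blk in \<open>auto simp: \<sigma>_def\<close>)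
qed

text \<open>In characteristic 0 this shows that such a matrix has finite order only if
  \<open>B\<close> is zero.\<close>

lemma four_block_unipotent_pow:
  assumes "B \<in> carrier_mat d e"
  shows "four_block_mat (1\<^sub>m d) B (0\<^sub>m e d) (1\<^sub>m e) ^\<^sub>m k =
    four_block_mat (1\<^sub>m d) (of_nat k \<cdot>\<^sub>m B) (0\<^sub>m e d) (1\<^sub>m e :: complex mat)"
proof (induction k)
  case 0
  have "of_nat 0 \<cdot>\<^sub>m B = 0\<^sub>m d e" using assms by (intro eq_matI) auto
  then show ?case by simp
next
  case (Suc k)
  have "of_nat k \<cdot>\<^sub>m B + B = of_nat (Suc k) \<cdot>\<^sub>m B" using assms
    by (intro eq_matI) (auto simp: algebra_simps)
  moreover have "1\<^sub>m d * B + of_nat k \<cdot>\<^sub>m B * 1\<^sub>m e = B + of_nat k \<cdot>\<^sub>m B" using assms by simp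
  moreover have "B + of_nat k \<cdot>\<^sub>m B = of_nat k \<cdot>\<^sub>m B + B" using assms by (intro comm_add_mat) auto
  ultimately show ?case using assms
    by (simp add: Suc.IH) (subst mult_four_block_mat[of _ d d _ e _ e _ _ d _ e], auto)
qed

text \<open>Splitting off blocks until all are irreducible adds up traces. The third conclusion
  replaces complete reducibility: it lets the kernel be read off from the factors although the
  off-diagonal blocks were never removed.\<close>

theorem composition_list:
  assumes H: "group H" and fin: "finite (carrier H)" and rep: "complex_rep H n \<rho>"
  obtains rs where "\<And>k \<sigma>. (k,\<sigma>) \<in> set rs \<Longrightarrow> irreducible_rep H k \<sigma>"
    "\<And>g. g \<in> carrier H \<Longrightarrow> trace_mat (\<rho> g) = (\<Sum>(k,\<sigma>)\<leftarrow>rs. trace_mat (\<sigma> g))"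
    "\<And>g. g \<in> carrier H \<Longrightarrow> (\<And>k \<sigma>. (k,\<sigma>) \<in> set rs \<Longrightarrow> \<sigma> g = 1\<^sub>m k) \<Longrightarrow> \<rho> g = 1\<^sub>m n"
proof -
  define good where "good n \<rho> rs \<longleftrightarrow> (\<forall>(k,\<sigma>) \<in> set rs. irreducible_rep H k \<sigma>) \<and>
    (\<forall>g \<in> carrier H. trace_mat (\<rho> g) = (\<Sum>(k,\<sigma>)\<leftarrow>rs. trace_mat (\<sigma> g))) \<and>
    (\<forall>g \<in> carrier H. (\<forall>(k,\<sigma>) \<in> set rs. \<sigma> g = 1\<^sub>m k) \<longrightarrow> \<rho> g = 1\<^sub>m n)"
    for n \<rho> rs
  have "\<exists>rs. good n \<rho> rs"
    using rep
  proof (induction n arbitrary: \<rho> rule: less_induct)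
    case (less n)
    note R = complex_repD[OF H less.prems]
    show ?case
    proof (cases "irreducible_rep H n \<rho>")
      case True
      then show ?thesis unfolding good_def by (intro exI[of _ "[(n,\<rho>)]"]) auto
    next
      case False
      obtain P Q d e X B Y where PQ: "P \<in> carrier_mat n n" "Q \<in> carrier_mat n n" "P * Q = 1\<^sub>m n" "Q * P = 1\<^sub>m n"
        and n: "n = d + e" and X: "complex_rep H d X" and Y: "complex_rep H e Y"
        and B: "\<And>g. g \<in> carrier H \<Longrightarrow> B g \<in> carrier_mat d e"
        and blk: "\<And>g. g \<in> carrier H \<Longrightarrow> Q * \<rho> g * P = four_block_mat (X g) (B g) (0\<^sub>m e d) (Y g)"
        by (rule reducible_rep_block[OF H less.prems False]) (rule that)
      have "d < n" "e < n" using complex_repD(1)[OF H X] complex_repD(1)[OF H Y] n by auto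
      from less.IH[OF this(1) X] less.IH[OF this(2) Y] obtain rs ss where
        rs: "good d X rs" and ss: "good e Y ss" by blast
      note rs = rs[unfolded good_def] and ss = ss[unfolded good_def]
      have \<sigma>: "complex_rep H n (\<lambda>g. Q * \<rho> g * P)" by (rule complex_rep_conj[OF H less.prems PQ])
      have bk: "\<rho> g = P * (Q * \<rho> g * P) * Q" if g: "g \<in> carrier H" for g
      proof -
        have "P * (Q * M) = M" if "M \<in> carrier_mat n n" for M :: "complex mat"
          using PQ that by (metis assoc_mult_mat left_mult_one_mat)
        then show ?thesis using R(2)[OF g] PQ
          by (simp add: assoc_mult_mat[of _ n n _ n _ n] mult_carrier_mat[of _ n n _ n])
      qed
      have "trace_mat (\<rho> g) = (\<Sum>(k,\<sigma>)\<leftarrow>rs @ ss. trace_mat (\<sigma> g))" if g: "g \<in> carrier H" for g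
      proof -
        have "trace_mat (Q * \<rho> g * P) = trace_mat (P * (Q * \<rho> g))"
          by (rule trace_mat_comm[of _ n n]) (use PQ R(2)[OF g] in auto)
        also have "P * (Q * \<rho> g) = (P * Q) * \<rho> g"
          by (rule assoc_mult_mat[OF PQ(1,2) R(2)[OF g], symmetric])
        also have "\<dots> = \<rho> g" using PQ R(2)[OF g] by simp
        finally have "trace_mat (\<rho> g) = trace_mat (X g) + trace_mat (Y g)"
          using blk[OF g] trace_four_block[of "X g" d "Y g" e "B g" "0\<^sub>m e d"]
            complex_repD(2)[OF H X g] complex_repD(2)[OF H Y g] by simp
        then show ?thesis using rs ss g by simp
      qed
      moreover have "\<rho> g = 1\<^sub>m n" if g: "g \<in> carrier H" and tr: "\<forall>(k,\<sigma>) \<in> set (rs @ ss). \<sigma> g = 1\<^sub>m k" for g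
      proof -
        \<comment> \<open>At such a \<open>g\<close> both diagonal blocks are identities. Raising to
          the group order gives the identity on one side and \<open>order H\<close> times
          \<open>B g\<close> in the corner on the other, so \<open>B g\<close> is zero.\<close>
        have 1: "Q * \<rho> g * P = four_block_mat (1\<^sub>m d) (B g) (0\<^sub>m e d) (1\<^sub>m e)"
          using blk[OF g] rs ss g tr by simp
        have "1\<^sub>m n = (Q * \<rho> g * P) ^\<^sub>m order H"
          using complex_rep_pow[OF H \<sigma> g, of "order H"] complex_repD(3)[OF H \<sigma>]
            group.pow_order_eq_1[OF H g] by simp
        also have "\<dots> = four_block_mat (1\<^sub>m d) (of_nat (order H) \<cdot>\<^sub>m B g) (0\<^sub>m e d) (1\<^sub>m e)"
          unfolding 1 by (rule four_block_unipotent_pow[OF B[OF g]])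
        finally have E: "1\<^sub>m n = four_block_mat (1\<^sub>m d) (of_nat (order H) \<cdot>\<^sub>m B g) (0\<^sub>m e d) (1\<^sub>m e)" .
        have "order H \<noteq> 0" using fin group.is_monoid[OF H] monoid.order_gt_0_iff_finite[of H] by simp
        then have "B g $$ (i,j) = 0" if "i < d" "j < e" for i j
          using arg_cong[OF E, of "\<lambda>M. M $$ (i,j+d)"] that B[OF g] n by auto
        then have "B g = 0\<^sub>m d e" using B[OF g] by (intro eq_matI) auto
        then have "Q * \<rho> g * P = 1\<^sub>m n" using 1 n by simp
        with bk[OF g] have "\<rho> g = P * 1\<^sub>m n * Q" by metis
        then show ?thesis using PQ by simp
      qed
      ultimately show ?thesis using rs ss unfolding good_def by (intro exI[of _ "rs @ ss"]) auto
    qed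
  qed
  then obtain rs where "good n \<rho> rs" by blast
  note rs = this[unfolded good_def]
  show thesis by (rule that[of rs]) (use rs in auto)
qed

section \<open>Averaging over the group, and the regular representation\<close>

lemma index_mult_mat_sum:
  assumes "X \<in> carrier_mat n m" "Y \<in> carrier_mat m l" "i < n" "j < l"
  shows "(X * Y) $$ (i,j) = (\<Sum>k<m. X $$ (i,k) * Y $$ (k,j))"
  using assms by (auto simp: scalar_prod_def lessThan_atLeast0 intro!: sum.cong)

lemma trace_mat_carrier: "X \<in> carrier_mat n m \<Longrightarrow> trace_mat X = (\<Sum>i<n. X $$ (i,i))"
  by (simp add: trace_mat_def)

lemma (in group) bij_betw_mult_left:
  assumes "h \<in> carrier G" shows "bij_betw (\<lambda>g. h \<otimes> g) (carrier G) (carrier G)"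
  using inj_on_cmult[OF assms] surj_const_mult[OF assms] by (auto simp: bij_betw_def)

lemma (in group) bij_betw_mult_right:
  assumes h: "h \<in> carrier G" shows "bij_betw (\<lambda>g. g \<otimes> h) (carrier G) (carrier G)"
  by (rule bij_betw_byWitness[of _ "\<lambda>g. g \<otimes> inv h"]) (use h in \<open>auto simp: m_assoc\<close>)

text \<open>The sum \<open>T\<close> of all matrices absorbs every \<open>\<rho> h\<close> from
  either side, so it is scalar by Schur's lemma. This is the absence of the trivial character from
  an irreducible representation of degree above 1.\<close>

lemma irreducible_sum_eq_0:
  assumes H: "group H" and fin: "finite (carrier H)" and irr: "irreducible_rep H n \<rho>" and n: "n \<noteq> 1"
  shows "(\<Sum>g\<in>carrier H. trace_mat (\<rho> g)) = 0"
proof -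
  have rep: "complex_rep H n \<rho>" using irr by (simp add: irreducible_rep_def)
  note R = complex_repD[OF H rep]
  interpret group H by fact
  define T where "T = mat n n (\<lambda>ij. \<Sum>g\<in>carrier H. \<rho> g $$ ij)"
  have T: "T \<in> carrier_mat n n" by (simp add: T_def)
  note bij = bij_betw_mult_left bij_betw_mult_right
  have left: "\<rho> h * T = T" if h: "h \<in> carrier H" for h
  proof (rule eq_matI)
    fix i j assume ij: "i < dim_row T" "j < dim_col T"
    then have ij: "i < n" "j < n" using T by auto
    have "(\<rho> h * T) $$ (i,j) = (\<Sum>k<n. \<rho> h $$ (i,k) * (\<Sum>g\<in>carrier H. \<rho> g $$ (k,j)))"
      using ij R(2)[OF h] by (auto simp: scalar_prod_def T_def lessThan_atLeast0 intro!: sum.cong)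
    also have "\<dots> = (\<Sum>g\<in>carrier H. \<Sum>k<n. \<rho> h $$ (i,k) * \<rho> g $$ (k,j))"
      by (simp add: sum_distrib_left) (rule sum.swap)
    also have "\<dots> = (\<Sum>g\<in>carrier H. \<rho> (h \<otimes>\<^bsub>H\<^esub> g) $$ (i,j))"
      using ij R(4)[OF h] by (intro sum.cong) (auto simp: index_mult_mat_sum[OF R(2)[OF h] R(2)])
    also have "\<dots> = (\<Sum>g\<in>carrier H. \<rho> g $$ (i,j))"
      by (rule sum.reindex_bij_betw[OF bij(1)[OF h]])
    finally show "(\<rho> h * T) $$ (i,j) = T $$ (i,j)" using ij by (simp add: T_def)
  qed (use T R(2)[OF h] in auto)
  have right: "T * \<rho> h = T" if h: "h \<in> carrier H" for h
  proof (rule eq_matI)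
    fix i j assume ij: "i < dim_row T" "j < dim_col T"
    then have ij: "i < n" "j < n" using T by auto
    have "(T * \<rho> h) $$ (i,j) = (\<Sum>k<n. (\<Sum>g\<in>carrier H. \<rho> g $$ (i,k)) * \<rho> h $$ (k,j))"
      using ij R(2)[OF h] by (auto simp: scalar_prod_def T_def lessThan_atLeast0 intro!: sum.cong)
    also have "\<dots> = (\<Sum>g\<in>carrier H. \<Sum>k<n. \<rho> g $$ (i,k) * \<rho> h $$ (k,j))"
      by (simp add: sum_distrib_right) (rule sum.swap)
    also have "\<dots> = (\<Sum>g\<in>carrier H. \<rho> (g \<otimes>\<^bsub>H\<^esub> h) $$ (i,j))"
      using ij R(4)[OF _ h] by (intro sum.cong) (auto simp: index_mult_mat_sum[OF R(2) R(2)[OF h]])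
    also have "\<dots> = (\<Sum>g\<in>carrier H. \<rho> g $$ (i,j))"
      by (rule sum.reindex_bij_betw[OF bij(2)[OF h]])
    finally show "(T * \<rho> h) $$ (i,j) = T $$ (i,j)" using ij by (simp add: T_def)
  qed (use T R(2)[OF h] in auto)
  obtain c where c: "T = c \<cdot>\<^sub>m 1\<^sub>m n"
    by (rule schur_scalar[OF H irr T]) (use left right in auto)
  have "c = 0"
  proof (rule ccontr)
    assume c0: "c \<noteq> 0"
    \<comment> \<open>If \<open>c\<close> is nonzero it cancels from
      \<open>\<rho> g * T = T\<close>, and every group element acts as the identity.\<close>
    have "\<rho> g = 1 \<cdot>\<^sub>m 1\<^sub>m n" if g: "g \<in> carrier H" for g
    proof -
      have "c \<cdot>\<^sub>m \<rho> g = c \<cdot>\<^sub>m 1\<^sub>m n"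
        using left[OF g] R(2)[OF g] unfolding c by (simp add: mult_smult_distrib[of _ n n _ n])
      then have "c * \<rho> g $$ (i,j) = c * (1\<^sub>m n $$ (i,j))" if "i < n" "j < n" for i j
        using arg_cong[of _ _ "\<lambda>M. M $$ (i,j)"] that R(2)[OF g]
        by (metis carrier_matD index_smult_mat(1) one_carrier_mat)
      then show ?thesis using c0 R(2)[OF g] by (intro eq_matI) auto
    qed
    then show False using irreducible_rep_scalars_degree_1[OF irr R(1)] n by blast
  qed
  have "(\<Sum>g\<in>carrier H. trace_mat (\<rho> g)) = (\<Sum>g\<in>carrier H. \<Sum>i<n. \<rho> g $$ (i,i))"
    using R(2) by (auto simp: trace_mat_def intro!: sum.cong)
  also have "\<dots> = (\<Sum>i<n. \<Sum>g\<in>carrier H. \<rho> g $$ (i,i))" by (rule sum.swap)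
  also have "\<dots> = trace_mat T" by (simp add: trace_mat_def T_def)
  also have "\<dots> = 0" using \<open>c = 0\<close> by (simp add: c trace_smult_one)
  finally show ?thesis .
qed

text \<open>First orthogonality relation for a single character, with inverse elements in place of
  complex conjugates so that unitarity never enters.\<close>

theorem irreducible_character_norm:
  assumes H: "group H" and fin: "finite (carrier H)" and irr: "irreducible_rep H n \<rho>"
  shows "(\<Sum>g\<in>carrier H. trace_mat (\<rho> g) * trace_mat (\<rho> (inv\<^bsub>H\<^esub> g))) = of_nat (order H)"
proof -
  have rep: "complex_rep H n \<rho>" using irr by (simp add: irreducible_rep_def)
  note R = complex_repD[OF H rep]
  interpret group H by fact
  let ?s = "\<lambda>g. \<rho> (inv\<^bsub>H\<^esub> g)"
  have s: "?s g \<in> carrier_mat n n" if "g \<in> carrier H" for g using that R(2) by simp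
  \<comment> \<open>\<open>T j k\<close> is the sum over g of \<open>\<rho> g\<close> times the
    matrix unit at (j,k) times the inverse of \<open>\<rho> g\<close>. It commutes with the
    representation, and its own entry at (j,k) is the product of diagonal entries needed for the
    norm.\<close>
  define T where "T j k = mat n n (\<lambda>(a,b). \<Sum>g\<in>carrier H. \<rho> g $$ (a,j) * ?s g $$ (k,b))" for j k
  have T: "T j k \<in> carrier_mat n n" for j k by (simp add: T_def)
  have comm: "T j k * \<rho> h = \<rho> h * T j k" if h: "h \<in> carrier H" and jk: "j < n" "k < n" for h j k
  proof (rule eq_matI)
    fix a b assume "a < dim_row (\<rho> h * T j k)" "b < dim_col (\<rho> h * T j k)"
    then have ab: "a < n" "b < n" using T[of j k] R(2)[OF h] by auto
    have "(\<rho> h * T j k) $$ (a,b) = (\<Sum>c<n. \<rho> h $$ (a,c) * (\<Sum>g\<in>carrier H. \<rho> g $$ (c,j) * ?s g $$ (k,b)))"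
      using ab R(2)[OF h] by (auto simp: scalar_prod_def T_def lessThan_atLeast0 intro!: sum.cong)
    also have "\<dots> = (\<Sum>g\<in>carrier H. \<Sum>c<n. \<rho> h $$ (a,c) * \<rho> g $$ (c,j) * ?s g $$ (k,b))"
      by (simp add: sum_distrib_left mult.assoc) (rule sum.swap)
    also have "\<dots> = (\<Sum>g\<in>carrier H. \<rho> (h \<otimes>\<^bsub>H\<^esub> g) $$ (a,j) * ?s g $$ (k,b))"
      using ab jk R(4)[OF h]
      by (intro sum.cong) (auto simp: index_mult_mat_sum[OF R(2)[OF h] R(2)] sum_distrib_right)
    \<comment> \<open>The inverse of g is rewritten as the inverse of hg times h, so that the whole
      summand depends on hg and the sum can be reindexed.\<close>
    also have "\<dots> = (\<Sum>g\<in>carrier H. \<rho> (h \<otimes>\<^bsub>H\<^esub> g) $$ (a,j) * \<rho> (inv\<^bsub>H\<^esub> (h \<otimes>\<^bsub>H\<^esub> g) \<otimes>\<^bsub>H\<^esub> h) $$ (k,b))"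
      using h by (intro sum.cong) (auto simp: inv_mult_group m_assoc)
    also have "\<dots> = (\<Sum>g\<in>carrier H. \<rho> g $$ (a,j) * \<rho> (inv\<^bsub>H\<^esub> g \<otimes>\<^bsub>H\<^esub> h) $$ (k,b))"
      by (rule sum.reindex_bij_betw[of "\<lambda>g. h \<otimes>\<^bsub>H\<^esub> g" _ _ "\<lambda>g. \<rho> g $$ (a,j) * \<rho> (inv\<^bsub>H\<^esub> g \<otimes>\<^bsub>H\<^esub> h) $$ (k,b)"])
        (rule bij_betw_mult_left[OF h])
    also have "\<dots> = (\<Sum>g\<in>carrier H. \<Sum>c<n. \<rho> g $$ (a,j) * ?s g $$ (k,c) * \<rho> h $$ (c,b))"
      using ab jk R(4)[OF _ h]
      by (intro sum.cong) (auto simp: index_mult_mat_sum[OF s R(2)[OF h]] sum_distrib_left mult.assoc)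
    also have "\<dots> = (\<Sum>c<n. (\<Sum>g\<in>carrier H. \<rho> g $$ (a,j) * ?s g $$ (k,c)) * \<rho> h $$ (c,b))"
      by (simp add: sum_distrib_right) (rule sum.swap)
    also have "\<dots> = (T j k * \<rho> h) $$ (a,b)"
      using ab R(2)[OF h] by (auto simp: scalar_prod_def T_def lessThan_atLeast0 intro!: sum.cong)
    finally show "(T j k * \<rho> h) $$ (a,b) = (\<rho> h * T j k) $$ (a,b)" by simp
  qed (use carrier_matD[OF T] R(2)[OF h] in auto)
  have tr: "trace_mat (T j k) = (if j = k then of_nat (order H) else 0)" if jk: "j < n" "k < n" for j k
  proof -
    have "trace_mat (T j k) = (\<Sum>g\<in>carrier H. \<Sum>a<n. ?s g $$ (k,a) * \<rho> g $$ (a,j))"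
      unfolding trace_mat_def by (subst sum.swap) (simp add: T_def mult.commute)
    also have "\<dots> = (\<Sum>g\<in>carrier H. (?s g * \<rho> g) $$ (k,j))"
      using jk by (intro sum.cong) (auto simp: index_mult_mat_sum[OF s R(2)])
    also have "\<dots> = (\<Sum>g\<in>carrier H. (if j = k then 1 else 0))"
      using complex_rep_inv(2)[OF H rep] jk by (intro sum.cong) auto
    finally show ?thesis by (simp add: Coset.order_def)
  qed
  \<comment> \<open>The scalar is the trace divided by the degree, and the trace of a conjugated
    matrix unit is 1 on the diagonal and 0 off it.\<close>
  have sc: "T j k $$ (j,k) = (if j = k then of_nat (order H) / of_nat n else 0)" if jk: "j < n" "k < n" for j k
  proof -
    obtain c where c: "T j k = c \<cdot>\<^sub>m 1\<^sub>m n"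
      by (rule schur_scalar[OF H irr T comm[OF _ jk]], assumption, rule that)
    have "of_nat n * c = (if j = k then of_nat (order H) else 0)"
      using tr[OF jk] unfolding c by (simp add: trace_smult_one)
    then show ?thesis unfolding c using jk R(1) by (auto simp: field_simps)
  qed
  have "(\<Sum>g\<in>carrier H. trace_mat (\<rho> g) * trace_mat (?s g)) =
    (\<Sum>g\<in>carrier H. \<Sum>j<n. \<Sum>k<n. \<rho> g $$ (j,j) * ?s g $$ (k,k))"
    by (intro sum.cong) (auto simp: trace_mat_carrier[OF R(2)] trace_mat_carrier[OF s] sum_product)
  also have "\<dots> = (\<Sum>j<n. \<Sum>k<n. \<Sum>g\<in>carrier H. \<rho> g $$ (j,j) * ?s g $$ (k,k))"
    by (subst sum.swap) (intro sum.cong refl sum.swap)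
  also have "\<dots> = (\<Sum>j<n. \<Sum>k<n. T j k $$ (j,k))"
    by (simp add: T_def)
  also have "\<dots> = (\<Sum>j<n. \<Sum>k<n. if j = k then of_nat (order H) / of_nat n else 0)"
    by (intro sum.cong) (auto simp: sc)
  also have "\<dots> = of_nat (order H)" using R(1) by simp
  finally show ?thesis .
qed

text \<open>Permutation matrices of left translation, which has fixed points only for the identity.
  Its composition factors are the supply of irreducible representations in later existence proofs,
  and it shows that faithful quasi-permutation representations exist.\<close>

lemma regular_rep_exists:
  assumes H: "group H" and fin: "finite (carrier H)"
  obtains \<rho> where "complex_rep H (order H) \<rho>"
    "\<And>g. g \<in> carrier H \<Longrightarrow> trace_mat (\<rho> g) = (if g = \<one>\<^bsub>H\<^esub> then of_nat (order H) else 0)"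
proof -
  interpret group H by fact
  define N where "N = order H"
  obtain f where f: "bij_betw f {..<N} (carrier H)"
    using ex_bij_betw_nat_finite[OF fin] unfolding N_def Coset.order_def lessThan_atLeast0 by blast
  have fc: "f i \<in> carrier H" if "i < N" for i using f that by (auto simp: bij_betw_def)
  have fi: "f i = f j \<longleftrightarrow> i = j" if "i < N" "j < N" for i j
    using f that by (auto simp: bij_betw_def inj_on_def)
  define \<rho> where "\<rho> g = mat N N (\<lambda>(i,j). if f i = g \<otimes>\<^bsub>H\<^esub> f j then 1 else 0 :: complex)" for g
  have N: "0 < N" using fin by (simp add: N_def order_gt_0_iff_finite)
  have "\<rho> (g \<otimes>\<^bsub>H\<^esub> h) = \<rho> g * \<rho> h" if gh: "g \<in> carrier H" "h \<in> carrier H" for g h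
  proof (rule eq_matI)
    fix i j assume "i < dim_row (\<rho> g * \<rho> h)" "j < dim_col (\<rho> g * \<rho> h)"
    then have ij: "i < N" "j < N" by (auto simp: \<rho>_def)
    have "(\<rho> g * \<rho> h) $$ (i,j) = (\<Sum>k<N. (if f i = g \<otimes>\<^bsub>H\<^esub> f k then 1 else 0) * (if f k = h \<otimes>\<^bsub>H\<^esub> f j then 1 else 0))"
      using ij by (auto simp: \<rho>_def scalar_prod_def lessThan_atLeast0 intro!: sum.cong)
    also have "\<dots> = (\<Sum>x\<in>carrier H. (if f i = g \<otimes>\<^bsub>H\<^esub> x then 1 else 0) * (if x = h \<otimes>\<^bsub>H\<^esub> f j then 1 else 0))"
      by (rule sum.reindex_bij_betw[OF f])
    also have "\<dots> = (\<Sum>x\<in>carrier H. if x = h \<otimes>\<^bsub>H\<^esub> f j then (if f i = g \<otimes>\<^bsub>H\<^esub> x then 1 else 0) else 0)"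
      by (intro sum.cong) auto
    also have "\<dots> = \<rho> (g \<otimes>\<^bsub>H\<^esub> h) $$ (i,j)"
      using ij gh fc fin by (simp add: \<rho>_def m_assoc)
    finally show "\<rho> (g \<otimes>\<^bsub>H\<^esub> h) $$ (i,j) = (\<rho> g * \<rho> h) $$ (i,j)" by simp
  qed (auto simp: \<rho>_def)
  moreover have "\<rho> \<one>\<^bsub>H\<^esub> = 1\<^sub>m N" using fc fi by (intro eq_matI) (auto simp: \<rho>_def)
  ultimately have rep: "complex_rep H N \<rho>"
    unfolding complex_rep_iff[OF H] using N by (auto simp: \<rho>_def)
  have "trace_mat (\<rho> g) = (if g = \<one>\<^bsub>H\<^esub> then of_nat N else 0)" if g: "g \<in> carrier H" for g
  proof -
    have "f i = g \<otimes>\<^bsub>H\<^esub> f i \<longleftrightarrow> g = \<one>\<^bsub>H\<^esub>" if "i < N" for i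
      using r_cancel_one' g fc[OF that] by metis
    then show ?thesis by (simp add: trace_mat_def \<rho>_def)
  qed
  with rep that show thesis unfolding N_def by blast
qed

text \<open>The list is nonempty because representations have positive degree. Only degree and trace
  are exported, since faithfulness will be tested on the trace.\<close>

lemma direct_sum_rep:
  assumes H: "group H" and rs: "rs \<noteq> []" "\<And>k \<sigma>. (k,\<sigma>) \<in> set rs \<Longrightarrow> complex_rep H k \<sigma>"
  obtains \<rho> where "complex_rep H (\<Sum>(k,\<sigma>)\<leftarrow>rs. k) \<rho>"
    "\<And>g. g \<in> carrier H \<Longrightarrow> trace_mat (\<rho> g) = (\<Sum>(k,\<sigma>)\<leftarrow>rs. trace_mat (\<sigma> g))"
proof -
  have "\<exists>\<rho>. complex_rep H (\<Sum>(k,\<sigma>)\<leftarrow>rs. k) \<rho> \<and>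
    (\<forall>g \<in> carrier H. trace_mat (\<rho> g) = (\<Sum>(k,\<sigma>)\<leftarrow>rs. trace_mat (\<sigma> g)))"
    using rs
  proof (induction rs rule: list_nonempty_induct)
    case (single x)
    then show ?case by (cases x) auto
  next
    case (cons x rs)
    obtain k \<sigma> where x: "x = (k,\<sigma>)" by fastforce
    define m where "m = (\<Sum>(k,\<sigma>)\<leftarrow>rs. k)"
    obtain \<tau> where \<tau>: "complex_rep H m \<tau>"
      "\<And>g. g \<in> carrier H \<Longrightarrow> trace_mat (\<tau> g) = (\<Sum>(k,\<sigma>)\<leftarrow>rs. trace_mat (\<sigma> g))"
      unfolding m_def using cons.IH cons.prems by force
    have \<sigma>: "complex_rep H k \<sigma>" using cons.prems x by auto
    define \<rho> where "\<rho> g = four_block_mat (\<sigma> g) (0\<^sub>m k m) (0\<^sub>m m k) (\<tau> g)" for g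
    note S = complex_repD[OF H \<sigma>] and T = complex_repD[OF H \<tau>(1)]
    have "\<rho> (g \<otimes>\<^bsub>H\<^esub> h) = \<rho> g * \<rho> h" if gh: "g \<in> carrier H" "h \<in> carrier H" for g h
      unfolding \<rho>_def
      by (subst mult_four_block_mat[of _ k k _ m _ m _ _ k _ m])
        (use S(2)[OF gh(1)] S(2)[OF gh(2)] T(2)[OF gh(1)] T(2)[OF gh(2)] S(4)[OF gh] T(4)[OF gh]
          in \<open>auto simp: right_add_zero_mat[of _ k k] left_add_zero_mat[of _ m m]\<close>)
    then have "complex_rep H (k + m) \<rho>"
      unfolding complex_rep_iff[OF H] using S T by (auto simp: \<rho>_def)
    moreover have "trace_mat (\<rho> g) = trace_mat (\<sigma> g) + trace_mat (\<tau> g)" if "g \<in> carrier H" for g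
      unfolding \<rho>_def by (rule trace_four_block) (use that S T in auto)
    ultimately show ?case using \<tau>(2) by (intro exI[of _ \<rho>]) (auto simp: x m_def)
  qed
  then show thesis using that by blast
qed

section \<open>Generators of abelian p-groups\<close>

context comm_group
begin

lemma subgroup_powers: "subgroup ((\<lambda>x. x [^] (p::nat)) ` carrier G) G"
proof
  fix x y assume "x \<in> (\<lambda>x. x [^] p) ` carrier G" "y \<in> (\<lambda>x. x [^] p) ` carrier G"
  then obtain a b where "a \<in> carrier G" "b \<in> carrier G" "x = a [^] p" "y = b [^] p" by blast
  then show "x \<otimes> y \<in> (\<lambda>x. x [^] p) ` carrier G"
    by (intro image_eqI[of _ _ "a \<otimes> b"]) (auto simp: nat_pow_distrib)
next
  fix x assume "x \<in> (\<lambda>x. x [^] p) ` carrier G"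
  then obtain a where "a \<in> carrier G" "x = a [^] p" by blast
  then show "inv x \<in> (\<lambda>x. x [^] p) ` carrier G"
    by (intro image_eqI[of _ _ "inv a"]) (auto simp: nat_pow_inv)
qed (auto intro: image_eqI[of _ _ \<one>])

text \<open>Kernel and image of the endomorphism x -> x^p, combined by the isomorphism theorem and
  Lagrange.\<close>

lemma card_torsion_times_powers:
  assumes fin: "finite (carrier G)"
  shows "card {x \<in> carrier G. x [^] p = \<one>} * card ((\<lambda>x. x [^] (p::nat)) ` carrier G) = order G"
proof -
  let ?F = "(\<lambda>x. x [^] p) ` carrier G"
  interpret F: subgroup ?F G by (rule subgroup_powers)
  interpret K: group_hom G "G\<lparr>carrier := ?F\<rparr>" "\<lambda>x. x [^] p"
    by (intro group_hom.intro group_hom_axioms.intro group_axioms F.subgroup_is_group)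
      (auto simp: hom_def nat_pow_distrib)
  have k: "kernel G (G\<lparr>carrier := ?F\<rparr>) (\<lambda>x. x [^] p) = {x \<in> carrier G. x [^] p = \<one>}"
    by (auto simp: kernel_def)
  have "card (carrier (G Mod kernel G (G\<lparr>carrier := ?F\<rparr>) (\<lambda>x. x [^] p))) = card ?F"
    using K.FactGroup_iso_set by (auto simp: iso_def dest: bij_betw_same_card)
  then have "card (rcosets (kernel G (G\<lparr>carrier := ?F\<rparr>) (\<lambda>x. x [^] p))) = card ?F"
    by (simp add: FactGroup_def)
  then show ?thesis using lagrange[OF K.subgroup_kernel] by (simp add: k mult.commute)
qed

text \<open>Modulo \<open>K\<close> the element \<open>s\<close> has order dividing p, so the new
  group is covered by the cosets of 1, s, ..., s^(p-1).\<close>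

lemma card_generate_insert_le:
  assumes fin: "finite (carrier G)" and K: "subgroup K G" and s: "s \<in> carrier G"
    and p: "0 < p" "s [^] (p::nat) \<in> K"
  shows "card (generate G (insert s K)) \<le> p * card K"
proof -
  interpret K: subgroup K G by fact
  \<comment> \<open>Integer exponents make closure under inverses immediate; they are reduced modulo
    p only for the count.\<close>
  define U where "U = {x \<otimes> s [^] i | x i. x \<in> K \<and> i \<in> (UNIV :: int set)}"
  have U: "subgroup U G"
  proof
    show "U \<subseteq> carrier G" using s K.subset by (auto simp: U_def)
    show "\<one> \<in> U" unfolding U_def using s K.one_closed by (auto intro!: exI[of _ \<one>] exI[of _ 0])
  next
    fix u v assume "u \<in> U" "v \<in> U"
    then obtain x i y j where *: "u = x \<otimes> s [^] (i::int)" "v = y \<otimes> s [^] (j::int)" "x \<in> K" "y \<in> K"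
      by (auto simp: U_def)
    then have "u \<otimes> v = (x \<otimes> y) \<otimes> s [^] (i + j)" using s K.subset
      by (auto simp: int_pow_mult m_ac)
    then show "u \<otimes> v \<in> U" using * by (auto simp: U_def)
  next
    fix u assume "u \<in> U"
    then obtain x i where *: "u = x \<otimes> s [^] (i::int)" "x \<in> K" by (auto simp: U_def)
    then have "inv u = inv x \<otimes> s [^] (- i)" using s K.subset
      by (auto simp: int_pow_neg inv_mult)
    then show "inv u \<in> U" using * by (auto simp: U_def)
  qed
  have "insert s K \<subseteq> U"
  proof -
    have "s = \<one> \<otimes> s [^] (1::int)" "\<And>x. x \<in> K \<Longrightarrow> x = x \<otimes> s [^] (0::int)" using s K.subset by auto
    then show ?thesis unfolding U_def using K.one_closed by blast
  qed
  then have gU: "generate G (insert s K) \<subseteq> U" by (rule generate_subgroup_incl[OF _ U])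
  have "U \<subseteq> (\<lambda>(x,i). x \<otimes> s [^] i) ` (K \<times> {..<p})"
  proof
    fix u assume "u \<in> U"
    then obtain x i where *: "u = x \<otimes> s [^] (i::int)" "x \<in> K" by (auto simp: U_def)
    let ?r = "nat (i mod int p)"
    have "s [^] i = s [^] (int p * (i div int p)) \<otimes> s [^] (i mod int p)"
      using s by (simp add: int_pow_mult[symmetric])
    also have "s [^] (int p * (i div int p)) = (s [^] p) [^] (i div int p)"
      using s by (simp add: int_pow_pow[symmetric] int_pow_int)
    also have "s [^] (i mod int p) = s [^] ?r" using p by (simp add: int_pow_int[symmetric])
    finally have "u = (x \<otimes> (s [^] p) [^] (i div int p)) \<otimes> s [^] ?r"
      using * s K.subset by (auto simp: m_assoc)
    moreover have "x \<otimes> (s [^] p) [^] (i div int p) \<in> K"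
      using * p(2) subgroup_int_pow_closed[OF K] by auto
    moreover have "?r < p" using p(1) by (simp add: nat_less_iff)
    ultimately show "u \<in> (\<lambda>(x,i). x \<otimes> s [^] i) ` (K \<times> {..<p})"
      by (intro image_eqI[of _ _ "(x \<otimes> (s [^] p) [^] (i div int p), ?r)"]) auto
  qed
  moreover have fK: "finite K" using fin K.subset finite_subset by blast
  ultimately have "card U \<le> card (K \<times> {..<p})"
    by (intro surj_card_le) auto
  moreover have "finite U" using U fin subgroup.subset finite_subset by metis
  ultimately have "card (generate G (insert s K)) \<le> card (K \<times> {..<p})"
    using card_mono[OF _ gU] by linarith
  then show ?thesis by (simp add: card_cartesian_product mult.commute)
qed

lemma generate_insert_generate:
  assumes "T \<subseteq> carrier G" "s \<in> carrier G"
  shows "generate G (insert s T) = generate G (insert s (generate G T))"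
proof
  show "generate G (insert s T) \<subseteq> generate G (insert s (generate G T))"
    by (rule mono_generate) (auto intro: generate.incl)
  show "generate G (insert s (generate G T)) \<subseteq> generate G (insert s T)"
    by (rule generate_subgroup_incl)
      (use assms mono_generate[of T "insert s T"] in \<open>auto intro: generate.incl generate_is_subgroup\<close>)
qed

text \<open>The Frattini argument: generators modulo p-th powers already generate.\<close>

lemma generate_mod_powers:
  assumes ord: "order G = p ^ k" and S: "S \<subseteq> carrier G"
    and gen: "generate G ((\<lambda>x. x [^] (p::nat)) ` carrier G \<union> S) = carrier G"
  shows "generate G S = carrier G"
proof -
  let ?F = "(\<lambda>x. x [^] p) ` carrier G"
  interpret B: subgroup "generate G S" G by (rule generate_is_subgroup[OF S])
  interpret F: subgroup ?F G by (rule subgroup_powers)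
  have "generate G (?F \<union> S) \<subseteq> generate G S <#> ?F"
  proof (rule generate_subgroup_incl)
    show "subgroup (generate G S <#> ?F) G"
      by (rule mult_subgroups[OF B.subgroup_axioms F.subgroup_axioms])
    have mem: "b \<otimes> f \<in> generate G S <#> ?F" if "b \<in> generate G S" "f \<in> ?F" for b f
      using that unfolding set_mult_def by blast
    have "x \<in> generate G S <#> ?F" if "x \<in> ?F" for x
      using mem[OF B.one_closed that] F.mem_carrier[OF that] by simp
    moreover have "x \<in> generate G S <#> ?F" if "x \<in> S" for x
      using mem[OF generate.incl[OF that] F.one_closed] that S by (simp add: subset_iff)
    ultimately show "?F \<union> S \<subseteq> generate G S <#> ?F" by blast
  qed
  then have step: "\<exists>b\<in>generate G S. \<exists>y\<in>carrier G. x = b \<otimes> y [^] p" if "x \<in> carrier G" for x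
    using that gen unfolding set_mult_def by blast
  \<comment> \<open>Substituting the decomposition of y into itself raises the exponent from p^j to
    p^(j+1). Once p^j is the group order, the second factor is trivial.\<close>
  have "\<exists>b\<in>generate G S. \<exists>y\<in>carrier G. x = b \<otimes> y [^] (p ^ j)" if x: "x \<in> carrier G" for x j
  proof (induction j)
    case 0
    show ?case using x B.one_closed by (intro bexI[of _ \<one>] bexI[of _ x]) auto
  next
    case (Suc j)
    then obtain b y where b: "b \<in> generate G S" "y \<in> carrier G" "x = b \<otimes> y [^] (p ^ j)" by blast
    from step[OF b(2)] obtain c z where c: "c \<in> generate G S" "z \<in> carrier G" "y = c \<otimes> z [^] p" by blast
    have "x = (b \<otimes> c [^] (p ^ j)) \<otimes> z [^] (p ^ Suc j)"
      using b c B.subset by (auto simp: nat_pow_distrib nat_pow_pow m_assoc subset_iff)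
    moreover have "b \<otimes> c [^] (p ^ j) \<in> generate G S"
      using b c subgroup_int_pow_closed[OF B.subgroup_axioms c(1), of "int (p ^ j)"]
      by (simp only: int_pow_int B.m_closed)
    ultimately show ?case using c(2) by blast
  qed
  then have "\<exists>b\<in>generate G S. \<exists>y\<in>carrier G. x = b \<otimes> y [^] order G" if "x \<in> carrier G" for x
    using that unfolding ord by blast
  then have "x \<in> generate G S" if "x \<in> carrier G" for x
    using that pow_order_eq_1 B.mem_carrier by (metis r_one)
  then show ?thesis using B.subset by blast
qed

text \<open>Starting from the subgroup of p-th powers, each member of a minimal generating set
  multiplies the order by exactly p. Hence |G| = p^d |G^p|, while |G| is also the number of
  solutions of x^p = 1 times |G^p|. The quotient never has to be treated as a vector space.\<close>

theorem power_min_generators: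
  assumes p: "prime p" and fin: "finite (carrier G)" and ord: "order G = p ^ k"
  shows "p ^ min_generators G = card {x \<in> carrier G. x [^] p = \<one>}"
proof -
  let ?F = "(\<lambda>x. x [^] p) ` carrier G"
  have F: "subgroup ?F G" by (rule subgroup_powers)
  have FG: "?F \<subseteq> carrier G" by auto
  have p1: "1 < p" using p prime_gt_1_nat by blast
  define P where "P j \<longleftrightarrow> (\<exists>S. S \<subseteq> carrier G \<and> finite S \<and> card S = j \<and> generate G S = carrier G)" for j
  have min: "min_generators G = (LEAST j. P j)" unfolding min_generators_def P_def ..
  have "P (card (carrier G))" unfolding P_def
    using fin generate_incl[of "carrier G"] by (auto intro!: exI[of _ "carrier G"] generate.incl)
  then have "P (min_generators G)" unfolding min by (rule LeastI)
  then obtain S where S: "S \<subseteq> carrier G" "finite S" "card S = min_generators G" "generate G S = carrier G"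
    unfolding P_def by blast
  have least: "min_generators G \<le> card T" if "T \<subseteq> carrier G" "finite T" "generate G T = carrier G" for T
    unfolding min by (rule Least_le) (use that in \<open>auto simp: P_def\<close>)
  have g0: "generate G (?F \<union> {}) = ?F"
    using generateI[OF F, of ?F] by (metis F Un_empty_right generateI subset_refl)
  \<comment> \<open>At most a factor p by the coset count. At least a factor p because the inclusion
    is strict and both orders are powers of p.\<close>
  have step: "p * card (generate G (?F \<union> T)) = card (generate G (?F \<union> insert s T))"
    if T: "T \<subseteq> S" "s \<in> S" "s \<notin> T" for s T
  proof -
    have TG: "?F \<union> T \<subseteq> carrier G" "s \<in> carrier G" using T S FG by auto
    let ?K = "generate G (?F \<union> T)" and ?L = "generate G (?F \<union> insert s T)"
    have K: "subgroup ?K G" and L: "subgroup ?L G"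
      using TG by (auto intro!: generate_is_subgroup)
    have LK: "?L = generate G (insert s ?K)" using generate_insert_generate[OF TG] by simp
    have "s [^] p \<in> ?K" using TG by (intro generate.incl) auto
    then have le: "card ?L \<le> p * card ?K"
      unfolding LK by (intro card_generate_insert_le[OF fin K TG(2)]) (use p1 in auto)
    \<comment> \<open>Otherwise \<open>S - {s}\<close> would generate modulo p-th powers, hence
      outright, against the minimality of \<open>S\<close>.\<close>
    have "s \<notin> ?K"
    proof
      assume sK: "s \<in> ?K"
      let ?M = "generate G (?F \<union> (S - {s}))"
      have MG: "?F \<union> (S - {s}) \<subseteq> carrier G" using FG S by auto
      have "?K \<subseteq> ?M" by (rule mono_generate) (use T in auto)
      then have "S \<subseteq> ?M" using sK by (auto intro: generate.incl)
      then have "carrier G \<subseteq> ?M"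
        using generate_subgroup_incl[OF _ generate_is_subgroup[OF MG]] S(4) by metis
      then have "?M = carrier G" using generate_incl[OF MG] by blast
      then have "generate G (S - {s}) = carrier G"
        by (rule generate_mod_powers[OF ord, rotated]) (use S(1) in blast)
      then have "min_generators G \<le> card (S - {s})" using S by (intro least) auto
      then show False using S T(2) by (metis card_Diff1_less not_less)
    qed
    moreover have "s \<in> ?L" by (intro generate.incl) auto
    moreover have KL: "?K \<subseteq> ?L" by (rule mono_generate) auto
    moreover have fL: "finite ?L" using fin L subgroup.subset finite_subset by metis
    ultimately have lt: "card ?K < card ?L" by (intro psubset_card_mono) auto
    obtain a where a: "card ?K = p ^ a"
      using lagrange[OF K] ord p by (metis divides_primepow_nat dvd_triv_right)
    obtain b where b: "card ?L = p ^ b"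
      using lagrange[OF L] ord p by (metis divides_primepow_nat dvd_triv_right)
    have "a < b" using lt a b p1 by simp
    then have "p ^ Suc a \<le> p ^ b" using p1 by (intro power_increasing) auto
    then show ?thesis using le a b by simp
  qed
  have "card (generate G (?F \<union> T)) = p ^ card T * card ?F" if "T \<subseteq> S" for T
    using finite_subset[OF that S(2)] that
  proof (induction T rule: finite_induct)
    case empty
    then show ?case using g0 by simp
  next
    case (insert s T)
    then show ?case using step[of T s] by simp
  qed
  from this[of S] have "card (generate G (?F \<union> S)) = p ^ min_generators G * card ?F" using S by simp
  moreover have "generate G (?F \<union> S) = carrier G"
    using mono_generate[of S "?F \<union> S"] S(1,4) generate_incl[of "?F \<union> S"] FG by blast
  ultimately have "p ^ min_generators G * card ?F = card {x \<in> carrier G. x [^] p = \<one>} * card ?F"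
    using card_torsion_times_powers[OF fin, of p] by (metis Coset.order_def)
  moreover have "card ?F \<noteq> 0" using fin by (auto simp: carrier_not_empty)
  ultimately show ?thesis by simp
qed

end

text \<open>The solutions of x^p = 1 in \<open>D\<close> are among those in \<open>A\<close>, and
  equal generator numbers make the two finite sets equally large.\<close>

theorem p_torsion_subset_if_min_generators_eq:
  assumes A: "comm_group A" and fin: "finite (carrier A)" and p: "prime p" and ord: "order A = p ^ k"
    and D: "subgroup D A" and eq: "min_generators (A\<lparr>carrier := D\<rparr>) = min_generators A"
    and z: "z \<in> carrier A" "z [^]\<^bsub>A\<^esub> p = \<one>\<^bsub>A\<^esub>"
  shows "z \<in> D"
proof -
  interpret A: comm_group A by fact
  interpret D: subgroup D A by fact
  let ?D = "A\<lparr>carrier := D\<rparr>"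
  have cD: "comm_group ?D"
    by (rule group.group_comm_groupI[OF D.subgroup_is_group[OF A.group_axioms]]) (auto simp: A.m_comm)
  have fD: "finite D" using fin D.subset finite_subset by blast
  have "card D dvd p ^ k" using A.lagrange[OF D] ord by (metis dvd_triv_right)
  then obtain l where "card D = p ^ l" using divides_primepow_nat[OF p] by blast
  then have l: "order ?D = p ^ l" by (simp add: Coset.order_def)
  have pw: "x [^]\<^bsub>?D\<^esub> n = x [^]\<^bsub>A\<^esub> n" for x and n :: nat by (simp add: nat_pow_def)
  have "card {x \<in> D. x [^]\<^bsub>A\<^esub> p = \<one>\<^bsub>A\<^esub>} = card {x \<in> carrier A. x [^]\<^bsub>A\<^esub> p = \<one>\<^bsub>A\<^esub>}"
    using comm_group.power_min_generators[OF cD p _ l] A.power_min_generators[OF p fin ord] eq fD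
    by (simp add: pw)
  then have "{x \<in> D. x [^]\<^bsub>A\<^esub> p = \<one>\<^bsub>A\<^esub>} = {x \<in> carrier A. x [^]\<^bsub>A\<^esub> p = \<one>\<^bsub>A\<^esub>}"
    by (intro card_subset_eq) (use fin D.subset in auto)
  then show ?thesis using z by blast
qed

text \<open>If p^j is the least p-power exponent killing \<open>z\<close>, then j is positive and
  the exponent p^(j-1) does it.\<close>

lemma p_group_power_of_order_p:
  assumes A: "group A" and p: "order A = p ^ k" and z: "z \<in> carrier A" "z \<noteq> \<one>\<^bsub>A\<^esub>"
  obtains n :: nat where "z [^]\<^bsub>A\<^esub> n \<noteq> \<one>\<^bsub>A\<^esub>" "(z [^]\<^bsub>A\<^esub> n) [^]\<^bsub>A\<^esub> p = \<one>\<^bsub>A\<^esub>"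
proof -
  interpret group A by fact
  define j where "j = (LEAST j. z [^]\<^bsub>A\<^esub> (p ^ j) = \<one>\<^bsub>A\<^esub>)"
  have "z [^]\<^bsub>A\<^esub> (p ^ k) = \<one>\<^bsub>A\<^esub>" using pow_order_eq_1[OF z(1)] p by simp
  then have j: "z [^]\<^bsub>A\<^esub> (p ^ j) = \<one>\<^bsub>A\<^esub>" unfolding j_def by (rule LeastI)
  then obtain i where i: "j = Suc i" using z by (cases j) auto
  have "z [^]\<^bsub>A\<^esub> (p ^ i) \<noteq> \<one>\<^bsub>A\<^esub>" using not_less_Least[of i "\<lambda>j. z [^]\<^bsub>A\<^esub> (p ^ j) = \<one>\<^bsub>A\<^esub>"] i
    unfolding j_def[symmetric] by auto
  moreover have "(z [^]\<^bsub>A\<^esub> (p ^ i)) [^]\<^bsub>A\<^esub> p = \<one>\<^bsub>A\<^esub>"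
    using j i z by (simp add: nat_pow_pow mult.commute)
  ultimately show thesis by (rule that)
qed

section \<open>Linear characters\<close>

text \<open>Multiplication by the sum maps the powers of a primitive N-th root of unity to integer
  combinations of themselves. So the sum is an eigenvalue of an integer matrix, hence an algebraic
  integer.\<close>

lemma sum_list_roots_unity_rational_int:
  fixes ws :: "complex list"
  assumes N: "0 < N" and ws: "\<And>w. w \<in> set ws \<Longrightarrow> w ^ N = 1" and rat: "sum_list ws \<in> \<rat>"
  shows "sum_list ws \<in> \<int>"
proof -
  define \<zeta> where "\<zeta> = cis (2 * pi / real N)"
  have \<zeta>N: "\<zeta> ^ N = 1" using N by (simp add: \<zeta>_def DeMoivre)
  have \<zeta>mod: "\<zeta> ^ (i mod N) = \<zeta> ^ i" for i
  proof -
    have "\<zeta> ^ i = \<zeta> ^ (N * (i div N) + i mod N)" by simp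
    also have "\<dots> = (\<zeta> ^ N) ^ (i div N) * \<zeta> ^ (i mod N)" by (simp only: power_add power_mult)
    finally show ?thesis using \<zeta>N by simp
  qed
  have ex: "\<exists>k. w = \<zeta> ^ k" if w: "w \<in> set ws" for w
  proof -
    obtain k where "w = cis (2 * pi * real k / real N)"
      using bij_betw_roots_unity[OF N] ws[OF w] unfolding bij_betw_def by blast
    then show ?thesis by (intro exI[of _ k]) (simp add: \<zeta>_def DeMoivre mult_ac)
  qed
  define e where "e w = (SOME k. w = \<zeta> ^ k)" for w
  have e: "w = \<zeta> ^ e w" if "w \<in> set ws" for w
    unfolding e_def using ex[OF that] by (rule someI_ex)
  \<comment> \<open>Entry (i,j) counts the \<open>w\<close> in the list for which \<zeta>^i times
    \<open>w\<close> is \<zeta>^j, with exponents taken modulo N. The powers of \<zeta> may be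
    linearly dependent; only the eigenvector equation for \<open>v\<close> matters.\<close>
  define M :: "int mat" where "M = mat N N (\<lambda>(i,j). \<Sum>w\<leftarrow>ws. if (i + e w) mod N = j then 1 else 0)"
  define v where "v = vec N (\<lambda>j. \<zeta> ^ j)"
  have M: "M \<in> carrier_mat N N" by (simp add: M_def)
  have key: "(\<Sum>j<N. of_int (\<Sum>w\<leftarrow>us. if (i + e w) mod N = j then 1 else 0) * \<zeta> ^ j) = \<zeta> ^ i * sum_list us"
    if "set us \<subseteq> set ws" for us i
    using that
  proof (induction us)
    case (Cons w us)
    have "(\<Sum>j<N. of_int (if (i + e w) mod N = j then 1 else 0) * \<zeta> ^ j) =
      (\<Sum>j<N. if (i + e w) mod N = j then \<zeta> ^ j else 0)"
      by (intro sum.cong) auto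
    also have "\<dots> = \<zeta> ^ ((i + e w) mod N)" using N by simp
    also have "\<dots> = \<zeta> ^ i * w" using e[of w] Cons.prems by (simp add: \<zeta>mod power_add)
    finally have 1: "(\<Sum>j<N. of_int (if (i + e w) mod N = j then 1 else 0) * \<zeta> ^ j) = \<zeta> ^ i * w" .
    have "(\<Sum>j<N. of_int (\<Sum>w\<leftarrow>w # us. if (i + e w) mod N = j then 1 else 0) * \<zeta> ^ j) =
      (\<Sum>j<N. of_int (if (i + e w) mod N = j then 1 else 0) * \<zeta> ^ j) +
      (\<Sum>j<N. of_int (\<Sum>w\<leftarrow>us. if (i + e w) mod N = j then 1 else 0) * \<zeta> ^ j)"
      by (simp only: list.map sum_list.Cons of_int_add distrib_right sum.distrib)
    also have "\<dots> = \<zeta> ^ i * w + \<zeta> ^ i * sum_list us" using 1 Cons by simp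
    finally show ?case by (simp add: distrib_left)
  qed simp
  have cM: "map_mat of_int M \<in> carrier_mat N N" using M by simp
  have "eigenvector (map_mat of_int M) v (sum_list ws)"
    unfolding eigenvector_def
  proof (intro conjI)
    show "v \<in> carrier_vec (dim_row (map_mat of_int M))" using M by (simp add: v_def)
    \<comment> \<open>The first entry of \<open>v\<close> is \<zeta>^0 = 1, so \<open>v\<close> is a
      genuine eigenvector.\<close>
    have "v $ 0 \<noteq> 0\<^sub>v N $ 0" using N by (simp add: v_def)
    then show "v \<noteq> 0\<^sub>v (dim_row (map_mat of_int M))" using M by auto
    show "map_mat of_int M *\<^sub>v v = sum_list ws \<cdot>\<^sub>v v"
    proof (rule eq_vecI)
      fix i assume "i < dim_vec (sum_list ws \<cdot>\<^sub>v v)"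
      then have i: "i < N" by (simp add: v_def)
      have "(map_mat of_int M *\<^sub>v v) $ i =
        (\<Sum>j<N. of_int (\<Sum>w\<leftarrow>ws. if (i + e w) mod N = j then 1 else 0) * \<zeta> ^ j)"
        using i by (auto simp: scalar_prod_def v_def M_def lessThan_atLeast0 intro!: sum.cong)
      also have "\<dots> = (sum_list ws \<cdot>\<^sub>v v) $ i" using key[of ws i] i by (simp add: v_def)
      finally show "(map_mat of_int M *\<^sub>v v) $ i = (sum_list ws \<cdot>\<^sub>v v) $ i" .
    qed (use M in \<open>simp add: v_def\<close>)
  qed
  then have "eigenvalue (map_mat of_int M) (sum_list ws)" unfolding eigenvalue_def by blast
  then have "poly (map_poly of_int (char_poly M)) (sum_list ws) = 0"
    using eigenvalue_root_char_poly[OF cM] of_int_hom.char_poly_hom[OF M] by metis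
  moreover have "lead_coeff (char_poly M) = 1" using degree_monic_char_poly[OF M] by simp
  ultimately have "algebraic_int (sum_list ws)" unfolding algebraic_int_altdef_ipoly by blast
  then show ?thesis using rat by (rule rational_algebraic_int_is_int)
qed

text \<open>The value at the identity rules out the zero function; nonvanishing and absolute value 1
  on a finite group then follow from multiplicativity.\<close>

definition lin_char :: "('a, 'b) monoid_scheme \<Rightarrow> ('a \<Rightarrow> complex) \<Rightarrow> bool" where
  "lin_char H \<phi> \<longleftrightarrow> \<phi> \<one>\<^bsub>H\<^esub> = 1 \<and> (\<forall>x\<in>carrier H. \<forall>y\<in>carrier H. \<phi> (x \<otimes>\<^bsub>H\<^esub> y) = \<phi> x * \<phi> y)"

lemma lin_charD:
  assumes "lin_char H \<phi>"
  shows "\<phi> \<one>\<^bsub>H\<^esub> = 1" "x \<in> carrier H \<Longrightarrow> y \<in> carrier H \<Longrightarrow> \<phi> (x \<otimes>\<^bsub>H\<^esub> y) = \<phi> x * \<phi> y"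
  using assms by (auto simp: lin_char_def)

lemma lin_char_pow:
  assumes "group H" "lin_char H \<phi>" "x \<in> carrier H"
  shows "\<phi> (x [^]\<^bsub>H\<^esub> (n::nat)) = \<phi> x ^ n"
proof -
  interpret group H by fact
  show ?thesis using lin_charD[OF assms(2)] assms(3) by (induction n) (auto simp: nat_pow_Suc)
qed

lemma lin_char_root_of_unity:
  assumes "group H" "lin_char H \<phi>" "x \<in> carrier H"
  shows "\<phi> x ^ order H = 1"
  using lin_char_pow[OF assms, of "order H"] group.pow_order_eq_1[OF assms(1,3)] lin_charD(1)[OF assms(2)]
  by simp

lemma lin_char_norm:
  assumes "group H" "finite (carrier H)" "lin_char H \<phi>" "x \<in> carrier H"
  shows "cmod (\<phi> x) = 1"
proof -
  have "0 < order H" using assms(1,2) by (simp add: group.is_monoid monoid.order_gt_0_iff_finite)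
  moreover have "cmod (\<phi> x) ^ order H = 1"
    using lin_char_root_of_unity[OF assms(1,3,4)] by (metis norm_one norm_power)
  ultimately show ?thesis
    by (metis norm_ge_zero power_eq_iff_eq_base power_one zero_le_one)
qed

lemma lin_char_nonzero:
  assumes "group H" "finite (carrier H)" "lin_char H \<phi>" "x \<in> carrier H"
  shows "\<phi> x \<noteq> 0"
  using lin_char_norm[OF assms] by auto

text \<open>Translation by \<open>d\<close> permutes \<open>D\<close>, so the sum is unchanged when
  multiplied by \<phi>(d), which is not 1.\<close>

lemma lin_char_sum_subgroup:
  assumes H: "group H" and \<phi>: "lin_char H \<phi>" and D: "subgroup D H"
    and d: "d \<in> D" "\<phi> d \<noteq> 1"
  shows "(\<Sum>x\<in>D. \<phi> x) = 0"
proof -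
  interpret group H by fact
  interpret D: subgroup D H by fact
  interpret DG: group "H\<lparr>carrier := D\<rparr>" by (rule D.subgroup_is_group[OF H])
  have "\<phi> d * (\<Sum>x\<in>D. \<phi> x) = (\<Sum>x\<in>D. \<phi> (d \<otimes>\<^bsub>H\<^esub> x))"
    using d lin_charD(2)[OF \<phi>] by (auto simp: sum_distrib_left intro!: sum.cong)
  also have "\<dots> = (\<Sum>x\<in>D. \<phi> x)"
    by (rule sum.reindex_bij_betw) (use DG.bij_betw_mult_left[of d] d in simp)
  finally show ?thesis using d(2) by (metis mult_cancel_right1)
qed

text \<open>The quotient of the two characters is again a linear character and differs from 1 at
  \<open>x\<close>, so its sum over the group vanishes.\<close>

lemma lin_char_orthogonal:
  assumes H: "group H" and fin: "finite (carrier H)" and \<phi>: "lin_char H \<phi>" and \<mu>: "lin_char H \<mu>"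
    and ne: "x \<in> carrier H" "\<phi> x \<noteq> \<mu> x"
  shows "(\<Sum>x\<in>carrier H. \<phi> x / \<mu> x) = 0"
proof (rule lin_char_sum_subgroup[OF H _ group.subgroup_self[OF H] ne(1)])
  show "lin_char H (\<lambda>x. \<phi> x / \<mu> x)"
    using lin_charD[OF \<phi>] lin_charD[OF \<mu>] by (auto simp: lin_char_def)
  show "\<phi> x / \<mu> x \<noteq> 1" using ne lin_char_nonzero[OF H fin \<mu>] by auto
qed

text \<open>Equality case of the triangle inequality: every real part is at most 1, so all of them
  are 1. It recovers the kernel of a sum of linear characters from the places where the sum attains
  its degree.\<close>

lemma sum_list_norm_1_eq_length:
  assumes "\<And>x. x \<in> set xs \<Longrightarrow> cmod (f x) = 1" "(\<Sum>x\<leftarrow>xs. f x) = of_nat (length xs)" "x \<in> set xs"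
  shows "f x = 1"
proof -
  have re: "Re (f y) \<le> 1" if "y \<in> set xs" for y using complex_Re_le_cmod[of "f y"] assms(1)[OF that] by simp
  have le: "(\<Sum>x\<leftarrow>ys. Re (f x)) \<le> real (length ys)" if "set ys \<subseteq> set xs" for ys
    using that by (induction ys) (use re in force)+
  obtain ys zs where xs: "xs = ys @ x # zs" using assms(3) by (meson split_list)
  have "(\<Sum>x\<leftarrow>xs. Re (f x)) = Re (\<Sum>x\<leftarrow>xs. f x)" by (induction xs) auto
  then have "(\<Sum>x\<leftarrow>xs. Re (f x)) = real (length xs)" using assms(2) by simp
  moreover have "(\<Sum>x\<leftarrow>ys. Re (f x)) \<le> real (length ys)" "(\<Sum>x\<leftarrow>zs. Re (f x)) \<le> real (length zs)"
    by (rule le, simp add: xs subset_iff)+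
  ultimately have "Re (f x) \<ge> 1" by (simp add: xs)
  then have "Re (f x) = 1" using re[OF assms(3)] by simp
  moreover from this have "Im (f x) = 0"
    using assms(1)[OF assms(3)] by (simp add: cmod_def)
  ultimately show ?thesis by (simp add: complex_eq_iff)
qed

lemma norm_sum_list_le_length:
  assumes "\<And>x. x \<in> set xs \<Longrightarrow> cmod (f x) = 1"
  shows "cmod (\<Sum>x\<leftarrow>xs. f x) \<le> real (length xs)"
  using assms
proof (induction xs)
  case (Cons x xs)
  have "cmod (f x + (\<Sum>x\<leftarrow>xs. f x)) \<le> cmod (f x) + cmod (\<Sum>x\<leftarrow>xs. f x)" by (rule norm_triangle_ineq)
  then show ?case using Cons by simp
qed simp

text \<open>
  Averaging the given character over \<open>D\<close> leaves the sum over \<open>Ms\<close>, which is therefore rational;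
  so is the sum over \<open>Ls\<close>, which, being an algebraic integer, is then an integer.
\<close>

theorem character_split:
  assumes A: "group A" and fin: "finite (carrier A)" and D: "subgroup D A"
    and Dne: "D \<noteq> {\<one>\<^bsub>A\<^esub>}"
    and Dpow: "\<And>z. z \<in> carrier A \<Longrightarrow> z \<noteq> \<one>\<^bsub>A\<^esub> \<Longrightarrow> \<exists>n::nat. z [^]\<^bsub>A\<^esub> n \<in> D \<and> z [^]\<^bsub>A\<^esub> n \<noteq> \<one>\<^bsub>A\<^esub>"
    and w: "0 < w"
    and Ls: "\<And>\<phi>. \<phi> \<in> set Ls \<Longrightarrow> lin_char A \<phi> \<and> (\<exists>d\<in>D. \<phi> d \<noteq> 1)"
    and Ms: "\<And>\<mu>. \<mu> \<in> set Ms \<Longrightarrow> lin_char A \<mu> \<and> (\<forall>d\<in>D. \<mu> d = 1)"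
    and faith: "\<And>z. z \<in> carrier A \<Longrightarrow> \<forall>\<phi>\<in>set Ls \<union> set Ms. \<phi> z = 1 \<Longrightarrow> z = \<one>\<^bsub>A\<^esub>"
    and nat: "\<And>z. z \<in> carrier A \<Longrightarrow> of_nat w * (\<Sum>\<phi>\<leftarrow>Ls. \<phi> z) + (\<Sum>\<mu>\<leftarrow>Ms. \<mu> z) \<in> \<nat>"
  shows "Ls \<noteq> []"
    and "z \<in> carrier A \<Longrightarrow> \<exists>t::int. (\<Sum>\<phi>\<leftarrow>Ls. \<phi> z) = of_int t \<and> 0 \<le> int w * t + int (length Ms)"
    and "z \<in> carrier A \<Longrightarrow> (\<Sum>\<phi>\<leftarrow>Ls. \<phi> z) = of_nat (length Ls) \<Longrightarrow> z = \<one>\<^bsub>A\<^esub>"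
proof -
  interpret group A by fact
  interpret D: subgroup D A by fact
  have N: "0 < order A" using fin by (simp add: order_gt_0_iff_finite)
  have cD: "0 < card D" using fin D.subset D.one_closed by (metis card_gt_0_iff empty_iff finite_subset)
  \<comment> \<open>All members of \<open>Ls\<close> are 1 at z, hence at a nontrivial power of z in
    \<open>D\<close>. There the members of \<open>Ms\<close> are 1 as well, which contradicts joint
    faithfulness.\<close>
  show 3: "z = \<one>\<^bsub>A\<^esub>" if z: "z \<in> carrier A" and eq: "(\<Sum>\<phi>\<leftarrow>Ls. \<phi> z) = of_nat (length Ls)" for z
  proof (rule ccontr)
    assume "z \<noteq> \<one>\<^bsub>A\<^esub>"
    then obtain n :: nat where n: "z [^]\<^bsub>A\<^esub> n \<in> D" "z [^]\<^bsub>A\<^esub> n \<noteq> \<one>\<^bsub>A\<^esub>" using Dpow[OF z] by blast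
    have "\<phi> z = 1" if "\<phi> \<in> set Ls" for \<phi>
      using sum_list_norm_1_eq_length[of Ls "\<lambda>\<phi>. \<phi> z" \<phi>] eq that Ls lin_char_norm[OF A fin _ z] by blast
    then have "\<phi> (z [^]\<^bsub>A\<^esub> n) = 1" if "\<phi> \<in> set Ls \<union> set Ms" for \<phi>
      using that Ls Ms n(1) lin_char_pow[OF A _ z] by (metis UnE power_one)
    then show False using faith[of "z [^]\<^bsub>A\<^esub> n"] n z by auto
  qed
  show "Ls \<noteq> []"
  proof
    assume "Ls = []"
    then have "carrier A \<subseteq> {\<one>\<^bsub>A\<^esub>}" using 3 by auto
    then show False using Dne D.subset D.one_closed by blast
  qed
  assume z: "z \<in> carrier A"
  have sumD: "(\<Sum>d\<in>D. \<Sum>\<phi>\<leftarrow>xs. \<phi> (z \<otimes>\<^bsub>A\<^esub> d)) = (\<Sum>\<phi>\<leftarrow>xs. \<phi> z * (\<Sum>d\<in>D. \<phi> d))"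
    if "\<And>\<phi>. \<phi> \<in> set xs \<Longrightarrow> lin_char A \<phi>" for xs :: "('a \<Rightarrow> complex) list"
    using that
  proof (induction xs)
    case (Cons \<phi> xs)
    have "(\<Sum>d\<in>D. \<phi> (z \<otimes>\<^bsub>A\<^esub> d)) = \<phi> z * (\<Sum>d\<in>D. \<phi> d)"
      using lin_charD(2)[of A \<phi>] Cons.prems z by (auto simp: sum_distrib_left intro!: sum.cong)
    then show ?case using Cons by (simp add: sum.distrib)
  qed simp
  have "(\<Sum>\<phi>\<leftarrow>Ls. \<phi> z * (\<Sum>d\<in>D. \<phi> d)) = (\<Sum>\<phi>\<leftarrow>Ls. 0)"
    using Ls lin_char_sum_subgroup[OF A _ D] by (intro arg_cong[of _ _ sum_list] map_cong refl) fastforce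
  then have L0: "(\<Sum>d\<in>D. \<Sum>\<phi>\<leftarrow>Ls. \<phi> (z \<otimes>\<^bsub>A\<^esub> d)) = 0"
    using sumD[of Ls] Ls by simp
  have "(\<Sum>\<mu>\<leftarrow>Ms. \<mu> z * (\<Sum>d\<in>D. \<mu> d)) = (\<Sum>\<mu>\<leftarrow>Ms. \<mu> z * of_nat (card D))"
  proof (intro arg_cong[of _ _ sum_list] map_cong refl)
    fix \<mu> assume "\<mu> \<in> set Ms"
    then have "(\<Sum>d\<in>D. \<mu> d) = (\<Sum>d\<in>D. 1)" using Ms by (intro sum.cong) auto
    then show "\<mu> z * (\<Sum>d\<in>D. \<mu> d) = \<mu> z * of_nat (card D)" by simp
  qed
  then have M1: "(\<Sum>d\<in>D. \<Sum>\<mu>\<leftarrow>Ms. \<mu> (z \<otimes>\<^bsub>A\<^esub> d)) = of_nat (card D) * (\<Sum>\<mu>\<leftarrow>Ms. \<mu> z)"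
    using sumD[of Ms] Ms by (simp add: sum_list_mult_const mult.commute)
  define \<theta> where "\<theta> y = of_nat w * (\<Sum>\<phi>\<leftarrow>Ls. \<phi> y) + (\<Sum>\<mu>\<leftarrow>Ms. \<mu> y)" for y
  have \<theta>: "\<theta> y \<in> \<nat>" if "y \<in> carrier A" for y using nat[OF that] by (simp add: \<theta>_def)
  have "(\<Sum>d\<in>D. \<theta> (z \<otimes>\<^bsub>A\<^esub> d)) = of_nat (card D) * (\<Sum>\<mu>\<leftarrow>Ms. \<mu> z)"
    using L0 M1 by (simp add: \<theta>_def sum.distrib sum_distrib_left[symmetric])
  then have M: "(\<Sum>\<mu>\<leftarrow>Ms. \<mu> z) = (\<Sum>d\<in>D. \<theta> (z \<otimes>\<^bsub>A\<^esub> d)) / of_nat (card D)"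
    using cD by (simp add: field_simps)
  have natrat: "x \<in> \<rat>" if "x \<in> \<nat>" for x :: complex using that by (auto elim: Nats_cases)
  have "(\<Sum>d\<in>D. \<theta> (z \<otimes>\<^bsub>A\<^esub> d)) \<in> \<rat>" using \<theta> natrat z by (intro Rats_sum) simp
  then have Mrat: "(\<Sum>\<mu>\<leftarrow>Ms. \<mu> z) \<in> \<rat>" unfolding M by (intro Rats_divide) auto
  have L: "(\<Sum>\<phi>\<leftarrow>Ls. \<phi> z) = (\<theta> z - (\<Sum>\<mu>\<leftarrow>Ms. \<mu> z)) / of_nat w" using w by (simp add: \<theta>_def)
  have "(\<Sum>\<phi>\<leftarrow>Ls. \<phi> z) \<in> \<rat>" unfolding L using natrat[OF \<theta>[OF z]] Mrat by (intro Rats_divide Rats_diff) auto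
  then have "(\<Sum>\<phi>\<leftarrow>Ls. \<phi> z) \<in> \<int>"
    by (intro sum_list_roots_unity_rational_int[OF N]) (use lin_char_root_of_unity[OF A _ z] Ls in auto)
  then obtain t where t: "(\<Sum>\<phi>\<leftarrow>Ls. \<phi> z) = of_int t" by (auto elim: Ints_cases)
  obtain k where k: "\<theta> z = of_nat k" using \<theta>[OF z] by (auto elim: Nats_cases)
  \<comment> \<open>The sum over \<open>Ms\<close> is the natural number k minus w t, and its real
    part is at most \<open>length Ms\<close>. As k is not negative, this bounds w t from
    below.\<close>
  have "(\<Sum>\<mu>\<leftarrow>Ms. \<mu> z) = complex_of_real (real k - real w * real_of_int t)"
    using k t by (simp add: \<theta>_def algebra_simps)
  moreover have "cmod (\<Sum>\<mu>\<leftarrow>Ms. \<mu> z) \<le> real (length Ms)"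
    by (rule norm_sum_list_le_length) (use Ms lin_char_norm[OF A fin _ z] in blast)
  ultimately have "real k - real w * real_of_int t \<le> real (length Ms)"
    using complex_Re_le_cmod[of "\<Sum>\<mu>\<leftarrow>Ms. \<mu> z"] by simp
  then have "real k \<le> real_of_int (int w * t + int (length Ms))" by simp
  then have "0 \<le> int w * t + int (length Ms)"
    by (metis of_int_0_le_iff of_nat_0_le_iff order_trans)
  with t show "\<exists>t::int. (\<Sum>\<phi>\<leftarrow>Ls. \<phi> z) = of_int t \<and> 0 \<le> int w * t + int (length Ms)" by blast
qed

section \<open>Characters of VZ-groups\<close>

lemma rep_degree_1_lin_char:
  assumes "group H" "complex_rep H 1 \<sigma>"
  shows "lin_char H (\<lambda>g. \<sigma> g $$ (0,0))"
proof -
  note R = complex_repD[OF assms]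
  show ?thesis
    unfolding lin_char_def using R(3,4) by (auto simp: index_mult_mat_sum[OF R(2) R(2)])
qed

lemma lin_char_derived:
  assumes H: "group H" and \<phi>: "lin_char H \<phi>" and d: "d \<in> derived H (carrier H)"
  shows "\<phi> d = 1"
proof -
  interpret group H by fact
  note L = lin_charD[OF \<phi>]
  have linv: "\<phi> x * \<phi> (inv\<^bsub>H\<^esub> x) = 1" if "x \<in> carrier H" for x
    using that L(1) L(2)[of x "inv\<^bsub>H\<^esub> x"] by simp
  have com: "h \<in> carrier H \<and> \<phi> h = 1" if h: "h \<in> derived_set H (carrier H)" for h
  proof -
    obtain x y where xy: "x \<in> carrier H" "y \<in> carrier H" "h = x \<otimes>\<^bsub>H\<^esub> y \<otimes>\<^bsub>H\<^esub> inv\<^bsub>H\<^esub> x \<otimes>\<^bsub>H\<^esub> inv\<^bsub>H\<^esub> y"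
      using h by blast
    then have "\<phi> h = (\<phi> x * \<phi> (inv\<^bsub>H\<^esub> x)) * (\<phi> y * \<phi> (inv\<^bsub>H\<^esub> y))" by (simp add: L(2) mult_ac)
    then show ?thesis using xy linv by simp
  qed
  \<comment> \<open>Membership in the carrier is carried through the induction because \<phi> is
    multiplicative only there.\<close>
  have "d \<in> carrier H \<and> \<phi> d = 1" using d unfolding derived_def
  proof (induction rule: generate.induct)
    case (inv h)
    then show ?case using com[of h] linv[of h] by simp
  next
    case (eng x y)
    then show ?case using L(2)[of x y] by simp
  next
    case (incl h)
    then show ?case by (rule com)
  qed (simp add: L(1))
  then show ?thesis by simp
qed

lemma rep_degree_1_derived:
  assumes H: "group H" and rep: "complex_rep H 1 \<sigma>" and d: "d \<in> derived H (carrier H)"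
  shows "\<sigma> d = 1\<^sub>m 1"
proof -
  have "d \<in> carrier H" using d group.derived_in_carrier[OF H] by blast
  then show ?thesis
    using complex_repD(2)[OF H rep] lin_char_derived[OF H rep_degree_1_lin_char[OF H rep] d]
    by (intro eq_matI) auto
qed

text \<open>Trivial commutators make all matrices commute; by Schur's lemma each is then scalar,
  which irreducibility allows only in degree 1. So nonlinear irreducible representations are exactly
  those nontrivial on the derived subgroup.\<close>

lemma irreducible_rep_derived_trivial:
  assumes H: "group H" and irr: "irreducible_rep H k \<sigma>"
    and triv: "\<And>d. d \<in> derived H (carrier H) \<Longrightarrow> \<sigma> d = 1\<^sub>m k"
  shows "k = 1"
proof -
  interpret group H by fact
  have rep: "complex_rep H k \<sigma>" using irr by (simp add: irreducible_rep_def)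
  note R = complex_repD[OF H rep]
  have comm: "\<sigma> g * \<sigma> h = \<sigma> h * \<sigma> g" if gh: "g \<in> carrier H" "h \<in> carrier H" for g h
  proof -
    let ?c = "g \<otimes>\<^bsub>H\<^esub> h \<otimes>\<^bsub>H\<^esub> inv\<^bsub>H\<^esub> g \<otimes>\<^bsub>H\<^esub> inv\<^bsub>H\<^esub> h"
    have c: "?c \<in> derived H (carrier H)" unfolding derived_def
      using gh by (intro generate.incl) blast
    have "g \<otimes>\<^bsub>H\<^esub> h = ?c \<otimes>\<^bsub>H\<^esub> (h \<otimes>\<^bsub>H\<^esub> g)"
    proof -
      have "inv\<^bsub>H\<^esub> h \<otimes>\<^bsub>H\<^esub> (h \<otimes>\<^bsub>H\<^esub> g) = g" using gh by (simp add: m_assoc[symmetric])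
      then show ?thesis using gh by (simp add: m_assoc)
    qed
    then have "\<sigma> (g \<otimes>\<^bsub>H\<^esub> h) = \<sigma> ?c * \<sigma> (h \<otimes>\<^bsub>H\<^esub> g)" using R(4)[of ?c "h \<otimes>\<^bsub>H\<^esub> g"] gh by simp
    then show ?thesis
      using triv[OF c] R(4)[OF gh] R(4)[OF gh(2,1)] left_mult_one_mat[OF R(2)] gh by (metis m_closed)
  qed
  have "\<exists>c. \<sigma> g = c \<cdot>\<^sub>m 1\<^sub>m k" if g: "g \<in> carrier H" for g
    using schur_scalar[OF H irr R(2)[OF g] comm[OF g]] by metis
  then show ?thesis by (rule irreducible_rep_scalars_degree_1[OF irr R(1)])
qed

lemma central_scalar:
  assumes H: "group H" and irr: "irreducible_rep H k \<sigma>" and z: "z \<in> carrier H"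
    and c: "\<And>g. g \<in> carrier H \<Longrightarrow> z \<otimes>\<^bsub>H\<^esub> g = g \<otimes>\<^bsub>H\<^esub> z"
  shows "\<sigma> z = \<sigma> z $$ (0,0) \<cdot>\<^sub>m 1\<^sub>m k"
proof -
  have rep: "complex_rep H k \<sigma>" using irr by (simp add: irreducible_rep_def)
  note R = complex_repD[OF H rep]
  have "\<sigma> z * \<sigma> g = \<sigma> g * \<sigma> z" if "g \<in> carrier H" for g
    using R(4)[OF z that] R(4)[OF that z] c[OF that] by simp
  then obtain c where "\<sigma> z = c \<cdot>\<^sub>m 1\<^sub>m k" using schur_scalar[OF H irr R(2)[OF z]] by metis
  then show ?thesis using R(1) by simp
qed

text \<open>The (0,0) entry names the scalar by which a central element acts; at other elements it
  has no meaning.\<close>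

definition central_char :: "('a \<Rightarrow> complex mat) \<Rightarrow> 'a \<Rightarrow> complex" where
  "central_char \<sigma> z = \<sigma> z $$ (0,0)"

lemma trace_central:
  assumes "group H" "irreducible_rep H k \<sigma>" "z \<in> carrier H"
    "\<And>g. g \<in> carrier H \<Longrightarrow> z \<otimes>\<^bsub>H\<^esub> g = g \<otimes>\<^bsub>H\<^esub> z"
  shows "trace_mat (\<sigma> z) = of_nat k * central_char \<sigma> z"
  using central_scalar[OF assms] trace_smult_one[of "\<sigma> z $$ (0,0)" k] by (simp add: central_char_def)

lemma central_char_lin_char:
  assumes H: "group H" and irr: "irreducible_rep H k \<sigma>" and Z: "Z \<subseteq> carrier H"
    and c: "\<And>z g. z \<in> Z \<Longrightarrow> g \<in> carrier H \<Longrightarrow> z \<otimes>\<^bsub>H\<^esub> g = g \<otimes>\<^bsub>H\<^esub> z"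
  shows "lin_char (H\<lparr>carrier := Z\<rparr>) (central_char \<sigma>)"
proof -
  have rep: "complex_rep H k \<sigma>" using irr by (simp add: irreducible_rep_def)
  note R = complex_repD[OF H rep]
  have "\<sigma> (y \<otimes>\<^bsub>H\<^esub> z) $$ (0,0) = \<sigma> y $$ (0,0) * \<sigma> z $$ (0,0)" if "y \<in> Z" "z \<in> Z" for y z
  proof -
    have yz: "y \<in> carrier H" "z \<in> carrier H" using that Z by auto
    have "\<sigma> (y \<otimes>\<^bsub>H\<^esub> z) = \<sigma> y $$ (0,0) \<cdot>\<^sub>m 1\<^sub>m k * \<sigma> z"
      using central_scalar[OF H irr yz(1)] c[OF that(1)] R(4)[OF yz] by metis
    also have "\<dots> = \<sigma> y $$ (0,0) \<cdot>\<^sub>m \<sigma> z" 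
      using R(2)[OF yz(2)] by (simp add: mult_smult_assoc_mat[of _ k k])
    finally show ?thesis using R(1) R(2)[OF yz(2)] by simp
  qed
  then show ?thesis using R(1,3) by (auto simp: lin_char_def central_char_def)
qed

text \<open>Stated for a general group so that it serves twice: for \<open>G\<close> with
  \<open>w\<close> the common nonlinear degree, and for the center itself with \<open>w = 1\<close>.
  \<open>Ls\<close> collects the central characters of the factors nontrivial on \<open>D\<close>,
  \<open>Ms\<close> those of the others.\<close>

theorem central_decomposition:
  assumes H: "group H" and fin: "finite (carrier H)" and rep: "complex_rep H n \<rho>"
    and Z: "Z \<subseteq> carrier H" "\<one>\<^bsub>H\<^esub> \<in> Z" and D: "D \<subseteq> Z"
    and c: "\<And>z g. z \<in> Z \<Longrightarrow> g \<in> carrier H \<Longrightarrow> z \<otimes>\<^bsub>H\<^esub> g = g \<otimes>\<^bsub>H\<^esub> z"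
    and types: "\<And>k \<sigma>. irreducible_rep H k \<sigma> \<Longrightarrow> (if \<forall>d\<in>D. \<sigma> d = 1\<^sub>m k then k = 1 else k = w)"
  obtains Ls Ms where
    "\<And>\<phi>. \<phi> \<in> set Ls \<Longrightarrow> lin_char (H\<lparr>carrier := Z\<rparr>) \<phi> \<and> (\<exists>d\<in>D. \<phi> d \<noteq> 1)"
    "\<And>\<mu>. \<mu> \<in> set Ms \<Longrightarrow> lin_char (H\<lparr>carrier := Z\<rparr>) \<mu> \<and> (\<forall>d\<in>D. \<mu> d = 1)"
    "\<And>z. z \<in> Z \<Longrightarrow> trace_mat (\<rho> z) = of_nat w * (\<Sum>\<phi>\<leftarrow>Ls. \<phi> z) + (\<Sum>\<mu>\<leftarrow>Ms. \<mu> z)"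
    "\<And>z. z \<in> Z \<Longrightarrow> \<forall>\<phi>\<in>set Ls \<union> set Ms. \<phi> z = 1 \<Longrightarrow> \<rho> z = 1\<^sub>m n"
    "n = w * length Ls + length Ms"
proof -
  obtain rs where irr: "\<And>k \<sigma>. (k,\<sigma>) \<in> set rs \<Longrightarrow> irreducible_rep H k \<sigma>"
    and tr: "\<And>g. g \<in> carrier H \<Longrightarrow> trace_mat (\<rho> g) = (\<Sum>(k,\<sigma>)\<leftarrow>rs. trace_mat (\<sigma> g))"
    and ker: "\<And>g. g \<in> carrier H \<Longrightarrow> (\<And>k \<sigma>. (k,\<sigma>) \<in> set rs \<Longrightarrow> \<sigma> g = 1\<^sub>m k) \<Longrightarrow> \<rho> g = 1\<^sub>m n"
    using composition_list[OF H fin rep] by metis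
  define triv where "triv = (\<lambda>(k, \<sigma>). \<forall>d\<in>D. \<sigma> d = (1\<^sub>m k :: complex mat))"
  define Ls where "Ls = map (\<lambda>(k,\<sigma>). central_char \<sigma>) (filter (\<lambda>x. \<not> triv x) rs)"
  define Ms where "Ms = map (\<lambda>(k,\<sigma>). central_char \<sigma>) (filter triv rs)"
  have sc: "\<sigma> z = central_char \<sigma> z \<cdot>\<^sub>m 1\<^sub>m k" if "(k,\<sigma>) \<in> set rs" "z \<in> Z" for k \<sigma> z
    using central_scalar[OF H irr[OF that(1)]] that(2) Z c unfolding central_char_def by blast
  \<comment> \<open>On \<open>Z\<close> each factor acts by a scalar, so the kernel condition on
    matrices becomes one on linear characters.\<close>
  have one: "\<sigma> z = 1\<^sub>m k \<longleftrightarrow> central_char \<sigma> z = 1" if kz: "(k,\<sigma>) \<in> set rs" "z \<in> Z" for k \<sigma> z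
  proof
    have "0 < k" using irr[OF kz(1)] by (simp add: irreducible_rep_def complex_rep_def)
    then show "\<sigma> z = 1\<^sub>m k \<Longrightarrow> central_char \<sigma> z = 1" by (simp add: central_char_def)
    assume "central_char \<sigma> z = 1"
    then have "\<sigma> z = 1 \<cdot>\<^sub>m 1\<^sub>m k" using sc[OF kz] by metis
    also have "\<dots> = 1\<^sub>m k" by (intro eq_matI) auto
    finally show "\<sigma> z = 1\<^sub>m k" .
  qed
  have trz: "trace_mat (\<rho> z) = of_nat w * (\<Sum>\<phi>\<leftarrow>Ls. \<phi> z) + (\<Sum>\<mu>\<leftarrow>Ms. \<mu> z)" if z: "z \<in> Z" for z
  proof -
    have "(\<Sum>(k,\<sigma>)\<leftarrow>xs. trace_mat (\<sigma> z)) =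
      of_nat w * (\<Sum>\<phi>\<leftarrow>map (\<lambda>(k,\<sigma>). central_char \<sigma>) (filter (\<lambda>x. \<not> triv x) xs). \<phi> z) +
      (\<Sum>\<mu>\<leftarrow>map (\<lambda>(k,\<sigma>). central_char \<sigma>) (filter triv xs). \<mu> z)" if "set xs \<subseteq> set rs" for xs
      using that
    proof (induction xs)
      case (Cons x xs)
      obtain k \<sigma> where x: "x = (k,\<sigma>)" by fastforce
      then have kr: "(k,\<sigma>) \<in> set rs" using Cons.prems by auto
      have "trace_mat (\<sigma> z) = of_nat k * central_char \<sigma> z"
        using trace_central[OF H irr[OF kr]] z Z c by blast
      moreover have "of_nat k = (if triv x then 1 else of_nat w :: complex)"
        using types[OF irr[OF kr]] by (auto simp: x triv_def split: if_splits)
      ultimately have "trace_mat (\<sigma> z) = (if triv x then 1 else of_nat w) * central_char \<sigma> z" by metis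
      moreover have "(\<lambda>(k,\<sigma>). central_char \<sigma>) x = central_char \<sigma>"
        "(\<lambda>(k,\<sigma>). trace_mat (\<sigma> z)) x = trace_mat (\<sigma> z)" by (simp_all add: x)
      ultimately show ?case using Cons by (simp add: algebra_simps)
    qed simp
    from this[of rs] show ?thesis using tr[of z] z Z by (auto simp: Ls_def Ms_def)
  qed
  show thesis
  proof (rule that[of Ls Ms])
    show "lin_char (H\<lparr>carrier := Z\<rparr>) \<phi> \<and> (\<exists>d\<in>D. \<phi> d \<noteq> 1)" if \<phi>: "\<phi> \<in> set Ls" for \<phi>
    proof -
      obtain k \<sigma> where k: "(k,\<sigma>) \<in> set rs" "\<not> triv (k,\<sigma>)" "\<phi> = central_char \<sigma>"
        using \<phi> by (auto simp: Ls_def)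
      then show ?thesis
        using central_char_lin_char[OF H irr[OF k(1)] Z(1) c] one[OF k(1)] D by (auto simp: triv_def)
    qed
    show "lin_char (H\<lparr>carrier := Z\<rparr>) \<mu> \<and> (\<forall>d\<in>D. \<mu> d = 1)" if \<mu>: "\<mu> \<in> set Ms" for \<mu>
    proof -
      obtain k \<sigma> where k: "(k,\<sigma>) \<in> set rs" "triv (k,\<sigma>)" "\<mu> = central_char \<sigma>"
        using \<mu> by (auto simp: Ms_def)
      then show ?thesis
        using central_char_lin_char[OF H irr[OF k(1)] Z(1) c] one[OF k(1)] D by (auto simp: triv_def)
    qed
    show "trace_mat (\<rho> z) = of_nat w * (\<Sum>\<phi>\<leftarrow>Ls. \<phi> z) + (\<Sum>\<mu>\<leftarrow>Ms. \<mu> z)" if "z \<in> Z" for z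
      by (rule trz[OF that])
    show "\<rho> z = 1\<^sub>m n" if z: "z \<in> Z" and t: "\<forall>\<phi>\<in>set Ls \<union> set Ms. \<phi> z = 1" for z
    proof (rule ker)
      show "\<sigma> z = 1\<^sub>m k" if k: "(k,\<sigma>) \<in> set rs" for k \<sigma>
      proof -
        have "central_char \<sigma> \<in> set Ls \<union> set Ms" using k by (auto simp: Ls_def Ms_def image_iff)
        then show ?thesis using one[OF k z] t by blast
      qed
    qed (use z Z in auto)
    have "lin_char (H\<lparr>carrier := Z\<rparr>) \<phi>" if "\<phi> \<in> set Ls \<union> set Ms" for \<phi>
      using that central_char_lin_char[OF H irr Z(1) c] by (auto simp: Ls_def Ms_def)
    then have o: "\<phi> \<one>\<^bsub>H\<^esub> = 1" if "\<phi> \<in> set Ls \<union> set Ms" for \<phi>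
      using that lin_charD(1) by fastforce
    have len: "(\<Sum>\<phi>\<leftarrow>xs. \<phi> \<one>\<^bsub>H\<^esub>) = of_nat (length xs)" if "set xs \<subseteq> set Ls \<union> set Ms" for xs
      using that by (induction xs) (auto simp: o)
    \<comment> \<open>The degree formula is the trace formula at the identity.\<close>
    have "complex_of_nat n = of_nat w * of_nat (length Ls) + of_nat (length Ms)"
      using trz[OF Z(2)] len[of Ls] len[of Ms] complex_repD(3)[OF H rep] by (simp add: trace_one)
    then show "n = w * length Ls + length Ms"
      by (metis of_nat_add of_nat_eq_iff of_nat_mult)
  qed
qed

section \<open>The center, and consequences of the VZ condition\<close>

lemma group_center_subgroup:
  assumes "group G" shows "subgroup (group_center G) G"
proof -
  interpret group G by fact
  show ?thesis
  proof
    fix x y assume "x \<in> group_center G" "y \<in> group_center G"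
    then have xy: "x \<in> carrier G" "y \<in> carrier G" "\<And>g. g \<in> carrier G \<Longrightarrow> x \<otimes>\<^bsub>G\<^esub> g = g \<otimes>\<^bsub>G\<^esub> x"
      "\<And>g. g \<in> carrier G \<Longrightarrow> y \<otimes>\<^bsub>G\<^esub> g = g \<otimes>\<^bsub>G\<^esub> y"
      by (simp_all add: group_center_def)
    have "x \<otimes>\<^bsub>G\<^esub> y \<otimes>\<^bsub>G\<^esub> g = g \<otimes>\<^bsub>G\<^esub> (x \<otimes>\<^bsub>G\<^esub> y)" if g: "g \<in> carrier G" for g
      using m_assoc[OF xy(1,2) g] m_assoc[OF xy(1) g xy(2)] m_assoc[OF g xy(1,2)] xy(3)[OF g] xy(4)[OF g]
      by simp
    then show "x \<otimes>\<^bsub>G\<^esub> y \<in> group_center G" using xy(1,2) by (simp add: group_center_def)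
  next
    fix x assume "x \<in> group_center G"
    then have x: "x \<in> carrier G" "\<And>g. g \<in> carrier G \<Longrightarrow> x \<otimes>\<^bsub>G\<^esub> g = g \<otimes>\<^bsub>G\<^esub> x"
      by (simp_all add: group_center_def)
    have "inv\<^bsub>G\<^esub> x \<otimes>\<^bsub>G\<^esub> g = g \<otimes>\<^bsub>G\<^esub> inv\<^bsub>G\<^esub> x" if g: "g \<in> carrier G" for g
    proof -
      have "x \<otimes>\<^bsub>G\<^esub> (g \<otimes>\<^bsub>G\<^esub> inv\<^bsub>G\<^esub> x) = g"
        using x(2)[OF g] x(1) g by (metis inv_closed m_assoc r_inv r_one)
      then show ?thesis using x(1) g by (metis inv_closed inv_solve_left m_closed)
    qed
    then show "inv\<^bsub>G\<^esub> x \<in> group_center G" using x(1) by (simp add: group_center_def)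
  qed (simp_all add: group_center_def subset_iff)
qed

lemma group_center_comm:
  "z \<in> group_center G \<Longrightarrow> g \<in> carrier G \<Longrightarrow> z \<otimes>\<^bsub>G\<^esub> g = g \<otimes>\<^bsub>G\<^esub> z"
  by (simp add: group_center_def)

lemma center_group_comm_group:
  assumes "group G" shows "comm_group (center_group G)"
proof (rule group.group_comm_groupI[OF subgroup.subgroup_is_group[OF group_center_subgroup[OF assms] assms]])
  fix x y assume "x \<in> carrier (center_group G)" "y \<in> carrier (center_group G)"
  then show "x \<otimes>\<^bsub>center_group G\<^esub> y = y \<otimes>\<^bsub>center_group G\<^esub> x"
    using group_center_comm[of x G y] subgroup.mem_carrier[OF group_center_subgroup[OF assms]] by simp
qed

lemma VZ_trace_eq_0:
  assumes "VZ_group G" "irreducible_rep G k \<sigma>" "k \<noteq> 1" "g \<in> carrier G" "g \<notin> group_center G"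
  shows "trace_mat (\<sigma> g) = 0"
proof -
  have G: "group G" using assms(1) by (simp add: VZ_group_def)
  have "\<sigma> \<one>\<^bsub>G\<^esub> = 1\<^sub>m k"
    using assms(2) complex_repD(3)[OF G] by (simp add: irreducible_rep_def)
  then have "trace_mat (\<sigma> \<one>\<^bsub>G\<^esub>) \<noteq> 1" using assms(3) by (simp add: trace_one)
  moreover have "irreducible_character G (\<lambda>g. trace_mat (\<sigma> g))"
    unfolding irreducible_character_def using assms(2) by blast
  ultimately show ?thesis using assms(1,4,5) unfolding VZ_group_def by blast
qed

text \<open>At a noncentral \<open>g\<close> of the derived subgroup linear factors of the regular
  representation contribute 1 and nonlinear ones 0. The regular character is 0 there, so no factor
  is linear. But then its sum over the group would be 0 rather than |G|.\<close>

lemma VZ_derived_subset_center: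
  assumes VZ: "VZ_group G" shows "derived G (carrier G) \<subseteq> group_center G"
proof
  have G: "group G" and fin: "finite (carrier G)" using VZ by (auto simp: VZ_group_def)
  interpret group G by fact
  fix g assume g: "g \<in> derived G (carrier G)"
  show "g \<in> group_center G"
  proof (rule ccontr)
    assume ng: "g \<notin> group_center G"
    have gc: "g \<in> carrier G" using g derived_in_carrier by blast
    have g1: "g \<noteq> \<one>\<^bsub>G\<^esub>" using ng subgroup.one_closed[OF group_center_subgroup[OF G]] by auto
    obtain \<rho> where rep: "complex_rep G (order G) \<rho>"
      and reg: "\<And>g. g \<in> carrier G \<Longrightarrow> trace_mat (\<rho> g) = (if g = \<one>\<^bsub>G\<^esub> then of_nat (order G) else 0)"
      using regular_rep_exists[OF G fin] by metis
    obtain rs where irr: "\<And>k \<sigma>. (k,\<sigma>) \<in> set rs \<Longrightarrow> irreducible_rep G k \<sigma>"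
      and tr: "\<And>g. g \<in> carrier G \<Longrightarrow> trace_mat (\<rho> g) = (\<Sum>(k,\<sigma>)\<leftarrow>rs. trace_mat (\<sigma> g))"
      using composition_list[OF G fin rep] by metis
    have "trace_mat (\<sigma> g) = (if k = 1 then 1 else 0)" if k: "(k,\<sigma>) \<in> set rs" for k \<sigma>
    proof (cases "k = 1")
      case True
      then have "\<sigma> g = 1\<^sub>m 1" using rep_degree_1_derived[OF G _ g] irr[OF k]
        by (simp add: irreducible_rep_def)
      then show ?thesis using True by (simp add: trace_one)
    next
      case False
      then show ?thesis using VZ_trace_eq_0[OF VZ irr[OF k]] gc ng by simp
    qed
    then have "(\<Sum>(k,\<sigma>)\<leftarrow>xs. trace_mat (\<sigma> g)) = of_nat (length (filter (\<lambda>(k,\<sigma>). k = 1) xs))"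
      if "set xs \<subseteq> set rs" for xs
      using that by (induction xs) (auto split: if_splits)
    from this[of rs] have "complex_of_nat (length (filter (\<lambda>(k,\<sigma>). k = 1) rs)) = 0"
      using tr[OF gc] reg[OF gc] g1 by simp
    then have k1: "k \<noteq> 1" if "(k,\<sigma>) \<in> set rs" for k \<sigma>
      using that by (auto simp: filter_empty_conv)
    have "(\<Sum>g\<in>carrier G. \<Sum>(k,\<sigma>)\<leftarrow>xs. trace_mat (\<sigma> g)) = 0" if "set xs \<subseteq> set rs" for xs
      using that
    proof (induction xs)
      case (Cons x xs)
      then show ?case using irreducible_sum_eq_0[OF G fin irr k1]
        by (cases x) (auto simp: sum.distrib)
    qed simp
    from this[of rs] have "(\<Sum>g\<in>carrier G. trace_mat (\<rho> g)) = 0" using tr by simp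
    moreover have "(\<Sum>g\<in>carrier G. trace_mat (\<rho> g)) = of_nat (order G)"
      using reg fin by simp
    moreover have "order G \<noteq> 0" using fin order_gt_0_iff_finite by simp
    ultimately show False by simp
  qed
qed

text \<open>In the norm sum each central element contributes k^2, since its scalar and that of its
  inverse cancel, and all other elements contribute 0.\<close>

lemma VZ_nonlinear_degree:
  assumes VZ: "VZ_group G" and irr: "irreducible_rep G k \<sigma>" and k: "k \<noteq> 1"
  shows "k\<^sup>2 * card (group_center G) = order G"
proof -
  have G: "group G" and fin: "finite (carrier G)" using VZ by (auto simp: VZ_group_def)
  interpret group G by fact
  interpret Z: subgroup "group_center G" G by (rule group_center_subgroup[OF G])
  interpret ZG: group "center_group G" by (rule Z.subgroup_is_group[OF G])
  have \<phi>: "lin_char (center_group G) (central_char \<sigma>)"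
    by (rule central_char_lin_char[OF G irr Z.subset group_center_comm])
  have "trace_mat (\<sigma> g) * trace_mat (\<sigma> (inv\<^bsub>G\<^esub> g)) = (if g \<in> group_center G then of_nat (k\<^sup>2) else 0)"
    if g: "g \<in> carrier G" for g
  proof (cases "g \<in> group_center G")
    case True
    then have "central_char \<sigma> g * central_char \<sigma> (inv\<^bsub>G\<^esub> g) = 1"
      using lin_charD(1)[OF \<phi>] lin_charD(2)[OF \<phi>, of g "inv\<^bsub>G\<^esub> g"] g by simp
    moreover have "trace_mat (\<sigma> x) = of_nat k * central_char \<sigma> x" if "x \<in> group_center G" for x
      using trace_central[OF G irr] that group_center_comm Z.mem_carrier by metis
    ultimately show ?thesis using True by (simp add: power2_eq_square)
  next
    case False
    then show ?thesis using VZ_trace_eq_0[OF VZ irr k g] by simp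
  qed
  then have "of_nat (order G) = (\<Sum>g\<in>carrier G. if g \<in> group_center G then complex_of_nat (k\<^sup>2) else 0)"
    using irreducible_character_norm[OF G fin irr] by (simp cong: sum.cong)
  also have "\<dots> = (\<Sum>g\<in>carrier G \<inter> group_center G. of_nat (k\<^sup>2))"
    by (rule sum.inter_restrict[OF fin, symmetric])
  also have "carrier G \<inter> group_center G = group_center G" using Z.subset by blast
  finally have "complex_of_nat (order G) = of_nat (k\<^sup>2 * card (group_center G))" by (simp add: mult.commute)
  then show ?thesis by (metis of_nat_eq_iff)
qed

lemma VZ_derived_nontrivial:
  assumes VZ: "VZ_group G" shows "derived G (carrier G) \<noteq> {\<one>\<^bsub>G\<^esub>}"
proof
  assume D: "derived G (carrier G) = {\<one>\<^bsub>G\<^esub>}"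
  have G: "group G" using VZ by (simp add: VZ_group_def)
  interpret group G by fact
  have "x \<otimes>\<^bsub>G\<^esub> y = y \<otimes>\<^bsub>G\<^esub> x" if xy: "x \<in> carrier G" "y \<in> carrier G" for x y
  proof -
    have "x \<otimes>\<^bsub>G\<^esub> y \<otimes>\<^bsub>G\<^esub> inv\<^bsub>G\<^esub> x \<otimes>\<^bsub>G\<^esub> inv\<^bsub>G\<^esub> y \<in> derived G (carrier G)"
      unfolding derived_def using xy by (intro generate.incl) blast
    then have "x \<otimes>\<^bsub>G\<^esub> y \<otimes>\<^bsub>G\<^esub> inv\<^bsub>G\<^esub> x \<otimes>\<^bsub>G\<^esub> inv\<^bsub>G\<^esub> y = \<one>\<^bsub>G\<^esub>" using D by simp
    then show ?thesis using xy by (metis inv_closed inv_solve_right l_one m_closed)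
  qed
  then have "comm_group G" by (rule group_comm_groupI)
  then show False using VZ by (simp add: VZ_group_def)
qed

text \<open>If all irreducible representations were linear, the derived subgroup would act trivially
  on every factor of the regular representation, hence on the regular representation itself, which
  is faithful.\<close>

lemma VZ_nonlinear_exists:
  assumes VZ: "VZ_group G"
  shows "\<exists>k \<sigma>. irreducible_rep G k \<sigma> \<and> k \<noteq> 1"
proof (rule ccontr)
  assume "\<not> ?thesis"
  then have k1: "k = 1" if "irreducible_rep G k \<sigma>" for k \<sigma> using that by blast
  have G: "group G" and fin: "finite (carrier G)" using VZ by (auto simp: VZ_group_def)
  interpret group G by fact
  obtain \<rho> where rep: "complex_rep G (order G) \<rho>"
    and reg: "\<And>g. g \<in> carrier G \<Longrightarrow> trace_mat (\<rho> g) = (if g = \<one>\<^bsub>G\<^esub> then of_nat (order G) else 0)"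
    using regular_rep_exists[OF G fin] by metis
  obtain rs where irr: "\<And>k \<sigma>. (k,\<sigma>) \<in> set rs \<Longrightarrow> irreducible_rep G k \<sigma>"
    and ker: "\<And>g. g \<in> carrier G \<Longrightarrow> (\<And>k \<sigma>. (k,\<sigma>) \<in> set rs \<Longrightarrow> \<sigma> g = 1\<^sub>m k) \<Longrightarrow> \<rho> g = 1\<^sub>m (order G)"
    using composition_list[OF G fin rep] by metis
  have "d = \<one>\<^bsub>G\<^esub>" if d: "d \<in> derived G (carrier G)" for d
  proof -
    have dc: "d \<in> carrier G" using d derived_in_carrier by blast
    have "\<rho> d = 1\<^sub>m (order G)"
    proof (rule ker[OF dc])
      fix k \<sigma> assume "(k,\<sigma>) \<in> set rs"
      then show "\<sigma> d = 1\<^sub>m k"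
        using irr k1 rep_degree_1_derived[OF G _ d] unfolding irreducible_rep_def by metis
    qed
    moreover have "order G \<noteq> 0" using fin order_gt_0_iff_finite by simp
    ultimately show ?thesis using reg[OF dc] by (auto simp: trace_one split: if_splits)
  qed
  moreover have "\<one>\<^bsub>G\<^esub> \<in> derived G (carrier G)" unfolding derived_def by (rule generate.one)
  ultimately show False using VZ_derived_nontrivial[OF VZ] by blast
qed

text \<open>A shadow of Frobenius reciprocity: pairing the regular character with \<phi> over the
  center gives |G|, not 0, so some factor has central character \<phi>. That factor is nontrivial at
  \<open>d\<close>, hence nonlinear of degree \<open>m\<close>, and the VZ condition fixes its trace
  off the center.\<close>

lemma VZ_lift_exists:
  assumes VZ: "VZ_group G" and \<phi>: "lin_char (center_group G) \<phi>"
    and d: "d \<in> derived G (carrier G)" "\<phi> d \<noteq> 1" and m: "m\<^sup>2 * card (group_center G) = order G"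
  obtains \<sigma> where "complex_rep G m \<sigma>"
    "\<And>g. g \<in> carrier G \<Longrightarrow> trace_mat (\<sigma> g) = (if g \<in> group_center G then of_nat m * \<phi> g else 0)"
proof -
  have G: "group G" and fin: "finite (carrier G)" using VZ by (auto simp: VZ_group_def)
  interpret group G by fact
  interpret Z: subgroup "group_center G" G by (rule group_center_subgroup[OF G])
  have ZG: "group (center_group G)" by (rule Z.subgroup_is_group[OF G])
  have fZ: "finite (group_center G)" using fin Z.subset finite_subset by blast
  obtain \<rho> where rep: "complex_rep G (order G) \<rho>"
    and reg: "\<And>g. g \<in> carrier G \<Longrightarrow> trace_mat (\<rho> g) = (if g = \<one>\<^bsub>G\<^esub> then of_nat (order G) else 0)"
    using regular_rep_exists[OF G fin] by metis
  obtain rs where irr: "\<And>k \<sigma>. (k,\<sigma>) \<in> set rs \<Longrightarrow> irreducible_rep G k \<sigma>"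
    and tr: "\<And>g. g \<in> carrier G \<Longrightarrow> trace_mat (\<rho> g) = (\<Sum>(k,\<sigma>)\<leftarrow>rs. trace_mat (\<sigma> g))"
    using composition_list[OF G fin rep] by metis
  have trc: "trace_mat (\<sigma> z) = of_nat k * central_char \<sigma> z" if "(k,\<sigma>) \<in> set rs" "z \<in> group_center G" for k \<sigma> z
    using trace_central[OF G irr[OF that(1)]] that(2) group_center_comm Z.mem_carrier by metis
  have "\<exists>k \<sigma>. (k,\<sigma>) \<in> set rs \<and> (\<forall>z\<in>group_center G. central_char \<sigma> z = \<phi> z)"
  proof (rule ccontr)
    assume no: "\<not> ?thesis"
    \<comment> \<open>On the center the trace of a factor is a multiple of its central character; by
      assumption this differs from \<phi>, so the two are orthogonal.\<close>
    have orth: "(\<Sum>z\<in>group_center G. trace_mat (\<sigma> z) / \<phi> z) = 0" if k: "(k,\<sigma>) \<in> set rs" for k \<sigma>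
    proof -
      obtain z where z: "z \<in> group_center G" "central_char \<sigma> z \<noteq> \<phi> z" using no k by blast
      have "lin_char (center_group G) (central_char \<sigma>)"
        by (rule central_char_lin_char[OF G irr[OF k] Z.subset group_center_comm])
      from lin_char_orthogonal[OF ZG _ this \<phi>] fZ z
      have "(\<Sum>z\<in>group_center G. central_char \<sigma> z / \<phi> z) = 0" by simp
      moreover have "(\<Sum>z\<in>group_center G. trace_mat (\<sigma> z) / \<phi> z) =
        (\<Sum>z\<in>group_center G. of_nat k * (central_char \<sigma> z / \<phi> z))"
        by (intro sum.cong) (simp_all add: trc[OF k])
      ultimately show ?thesis by (simp only: sum_distrib_left[symmetric] mult_zero_right)
    qed
    have "(\<Sum>z\<in>group_center G. (\<Sum>(k,\<sigma>)\<leftarrow>xs. trace_mat (\<sigma> z)) / \<phi> z) = 0" if "set xs \<subseteq> set rs" for xs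
      using that
    proof (induction xs)
      case (Cons x xs)
      then show ?case using orth by (cases x) (auto simp: sum.distrib add_divide_distrib)
    qed simp
    from this[of rs] have "(\<Sum>z\<in>group_center G. trace_mat (\<rho> z) / \<phi> z) = 0"
      using tr Z.mem_carrier by (simp cong: sum.cong)
    moreover have "(\<Sum>z\<in>group_center G. trace_mat (\<rho> z) / \<phi> z) =
      (\<Sum>z\<in>group_center G. if z = \<one>\<^bsub>G\<^esub> then of_nat (order G) else 0)"
      using reg Z.mem_carrier lin_charD(1)[OF \<phi>] by (intro sum.cong) auto
    ultimately have "order G = 0" using fZ Z.one_closed by simp
    then show False using fin order_gt_0_iff_finite by simp
  qed
  then obtain k \<sigma> where k: "(k,\<sigma>) \<in> set rs" "\<And>z. z \<in> group_center G \<Longrightarrow> central_char \<sigma> z = \<phi> z" by blast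
  have irk: "irreducible_rep G k \<sigma>" by (rule irr[OF k(1)])
  then have rk: "complex_rep G k \<sigma>" by (simp add: irreducible_rep_def)
  have "k \<noteq> 1"
  proof
    assume "k = 1"
    then have "\<sigma> d = 1\<^sub>m 1" using rep_degree_1_derived[OF G _ d(1)] rk by simp
    then have "central_char \<sigma> d = 1" by (simp add: central_char_def)
    then show False using k(2) d VZ_derived_subset_center[OF VZ] by auto
  qed
  have "card (group_center G) \<noteq> 0" using fZ Z.one_closed by (metis card_0_eq empty_iff)
  then have "k\<^sup>2 = m\<^sup>2"
    using VZ_nonlinear_degree[OF VZ irk \<open>k \<noteq> 1\<close>] m by (metis mult_right_cancel)
  then have "k = m" by simp
  show thesis
  proof (rule that)
    show "complex_rep G m \<sigma>" using rk \<open>k = m\<close> by simp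
    show "trace_mat (\<sigma> g) = (if g \<in> group_center G then of_nat m * \<phi> g else 0)" if "g \<in> carrier G" for g
      using VZ_trace_eq_0[OF VZ irk \<open>k \<noteq> 1\<close> that] trc[OF k(1)] k(2) \<open>k = m\<close> by simp
  qed
qed

section \<open>The minimal degree of faithful quasi-permutation representations\<close>

lemma faithful_repI:
  assumes H: "group H" and rep: "complex_rep H n \<rho>"
    and ker: "\<And>g. g \<in> carrier H \<Longrightarrow> \<rho> g = 1\<^sub>m n \<Longrightarrow> g = \<one>\<^bsub>H\<^esub>"
  shows "faithful_rep H n \<rho>"
proof -
  interpret group H by fact
  note R = complex_repD[OF H rep]
  have "x = y" if xy: "x \<in> carrier H" "y \<in> carrier H" "\<rho> x = \<rho> y" for x y
  proof -
    have "\<rho> (x \<otimes>\<^bsub>H\<^esub> inv\<^bsub>H\<^esub> y) = 1\<^sub>m n"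
      using R(4)[of x "inv\<^bsub>H\<^esub> y"] complex_rep_inv(1)[OF H rep xy(2)] xy by simp
    then have "x \<otimes>\<^bsub>H\<^esub> inv\<^bsub>H\<^esub> y = \<one>\<^bsub>H\<^esub>" using ker xy by simp
    then show ?thesis using xy by (metis inv_closed inv_inv inv_equality)
  qed
  then show ?thesis using rep by (auto simp: faithful_rep_def inj_on_def)
qed

text \<open>A matrix equal to the identity has trace \<open>n\<close>, so faithfulness can be
  certified by the character alone.\<close>

lemma min_quasi_perm_degree_le:
  assumes H: "group H" and rep: "complex_rep H n \<rho>"
    and tr: "\<And>g. g \<in> carrier H \<Longrightarrow> trace_mat (\<rho> g) \<in> \<nat>"
    and ker: "\<And>g. g \<in> carrier H \<Longrightarrow> trace_mat (\<rho> g) = of_nat n \<Longrightarrow> g = \<one>\<^bsub>H\<^esub>"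
  shows "min_quasi_perm_degree H \<le> n"
  unfolding min_quasi_perm_degree_def
proof (rule Least_le, intro exI conjI ballI)
  show "faithful_rep H n \<rho>" by (rule faithful_repI[OF H rep]) (simp add: ker trace_one)
  show "quasi_permutation_mat (\<rho> g)" if "g \<in> carrier H" for g
    using complex_repD(2)[OF H rep that] tr[OF that] by (simp add: quasi_permutation_mat_def)
qed

text \<open>The \<open>LEAST\<close> is attained because the regular representation is a candidate:
  its trace takes only the values 0 and |H|.\<close>

lemma min_quasi_perm_degree_attained:
  assumes H: "group H" and fin: "finite (carrier H)"
  obtains \<rho> where "complex_rep H (min_quasi_perm_degree H) \<rho>" "inj_on \<rho> (carrier H)"
    "\<And>g. g \<in> carrier H \<Longrightarrow> trace_mat (\<rho> g) \<in> \<nat>"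
proof -
  let ?P = "\<lambda>n. \<exists>\<rho>. faithful_rep H n \<rho> \<and> (\<forall>g \<in> carrier H. quasi_permutation_mat (\<rho> g))"
  obtain \<rho> where rep: "complex_rep H (order H) \<rho>"
    and reg: "\<And>g. g \<in> carrier H \<Longrightarrow> trace_mat (\<rho> g) = (if g = \<one>\<^bsub>H\<^esub> then of_nat (order H) else 0)"
    using regular_rep_exists[OF H fin] by metis
  have "0 < order H" using complex_repD(1)[OF H rep] .
  then have "faithful_rep H (order H) \<rho>"
    by (intro faithful_repI[OF H rep]) (use reg in \<open>force simp: trace_one split: if_splits\<close>)
  moreover have "quasi_permutation_mat (\<rho> g)" if "g \<in> carrier H" for g
    using complex_repD(2)[OF H rep that] reg[OF that] by (simp add: quasi_permutation_mat_def)
  ultimately have "?P (order H)" by blast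
  then have "?P (min_quasi_perm_degree H)" unfolding min_quasi_perm_degree_def by (rule LeastI)
  then show thesis using that unfolding faithful_rep_def quasi_permutation_mat_def by blast
qed

text \<open>The \<open>r\<close> trivial summands lift all traces by the same amount, which removes
  negative values without changing where the trace equals the degree.\<close>

lemma padded_direct_sum:
  assumes H: "group H" and xs: "xs \<noteq> []" and rep: "\<And>x. x \<in> set xs \<Longrightarrow> complex_rep H k (f x)"
  obtains \<rho> where "complex_rep H (k * length xs + r) \<rho>"
    "\<And>g. g \<in> carrier H \<Longrightarrow> trace_mat (\<rho> g) = (\<Sum>x\<leftarrow>xs. trace_mat (f x g)) + of_nat r"
proof -
  let ?rs = "map (\<lambda>x. (k, f x)) xs @ replicate r (1, \<lambda>_. 1\<^sub>m 1)"
  have "complex_rep H 1 (\<lambda>_. 1\<^sub>m 1)" unfolding complex_rep_iff[OF H] by simp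
  then have *: "complex_rep H l \<sigma>" if "(l,\<sigma>) \<in> set ?rs" for l \<sigma>
    using that rep by (auto simp: set_replicate_conv_if split: if_splits)
  have ne: "?rs \<noteq> []" using xs by simp
  obtain \<rho> where \<rho>: "complex_rep H (\<Sum>(k,\<sigma>)\<leftarrow>?rs. k) \<rho>"
    "\<And>g. g \<in> carrier H \<Longrightarrow> trace_mat (\<rho> g) = (\<Sum>(k,\<sigma>)\<leftarrow>?rs. trace_mat (\<sigma> g))"
    by (rule direct_sum_rep[OF H ne *], assumption, rule that)
  have "(\<Sum>(k,\<sigma>)\<leftarrow>?rs. k) = k * length xs + r"
    by (simp add: o_def sum_list_triv sum_list_replicate)
  moreover have "(\<Sum>(k,\<sigma>)\<leftarrow>?rs. trace_mat (\<sigma> g)) = (\<Sum>x\<leftarrow>xs. trace_mat (f x g)) + of_nat r" for g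
    by (simp add: o_def sum_list_replicate trace_one)
  ultimately show thesis using \<rho> that[of \<rho>] by simp
qed

lemma of_int_in_Nats: "0 \<le> t \<Longrightarrow> of_int t \<in> (\<nat> :: complex set)"
  by (metis of_nat_in_Nats of_nat_nat)

section \<open>Comparison of the two minimal degrees\<close>

theorem corollary4:
  fixes G :: "('a, 'b) monoid_scheme" and p :: nat
  assumes "prime p"
    and "finite_p_group p G"
    and "VZ_group G"
    and "min_generators (commutator_group G) = min_generators (center_group G)"
  shows "real (min_quasi_perm_degree G) =
    sqrt (real (order (G Mod group_center G))) * real (min_quasi_perm_degree (center_group G))"
proof -
  note VZ = \<open>VZ_group G\<close>
  have G: "group G" and fin: "finite (carrier G)" using VZ by (auto simp: VZ_group_def)
  obtain e where ordG: "order G = p ^ e" using assms(2) by (auto simp: finite_p_group_def)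
  interpret group G by fact
  let ?Z = "group_center G" and ?A = "center_group G" and ?D = "derived G (carrier G)"
  interpret Z: subgroup ?Z G by (rule group_center_subgroup[OF G])
  interpret A: comm_group ?A by (rule center_group_comm_group[OF G])
  have A: "group ?A" by (rule A.is_group)
  have fZ: "finite ?Z" using fin Z.subset finite_subset by blast
  then have fA: "finite (carrier ?A)" by simp
  have DZ: "?D \<subseteq> ?Z" by (rule VZ_derived_subset_center[OF VZ])
  have cZ: "card ?Z \<noteq> 0" using fZ Z.one_closed by (metis card_0_eq empty_iff)
  obtain l where l: "order ?A = p ^ l"
  proof -
    have "card ?Z dvd p ^ e" using lagrange[OF Z.subgroup_axioms] ordG by (metis dvd_triv_right)
    then show thesis using divides_primepow_nat[OF assms(1)] that by (auto simp: Coset.order_def)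
  qed
  have DA: "subgroup ?D ?A"
    by (rule subgroup_incl[OF derived_is_subgroup Z.subgroup_axioms DZ]) auto
  have Dne: "?D \<noteq> {\<one>\<^bsub>?A\<^esub>}" using VZ_derived_nontrivial[OF VZ] by simp
  \<comment> \<open>The only use of the generator hypothesis: a power of z of order p exists and
    must lie in the derived subgroup.\<close>
  have Dpow: "\<exists>n::nat. z [^]\<^bsub>?A\<^esub> n \<in> ?D \<and> z [^]\<^bsub>?A\<^esub> n \<noteq> \<one>\<^bsub>?A\<^esub>"
    if z: "z \<in> carrier ?A" "z \<noteq> \<one>\<^bsub>?A\<^esub>" for z
  proof -
    obtain n :: nat where n: "z [^]\<^bsub>?A\<^esub> n \<noteq> \<one>\<^bsub>?A\<^esub>" "(z [^]\<^bsub>?A\<^esub> n) [^]\<^bsub>?A\<^esub> p = \<one>\<^bsub>?A\<^esub>"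
      by (rule p_group_power_of_order_p[OF A l z])
    have "z [^]\<^bsub>?A\<^esub> n \<in> ?D"
      by (rule p_torsion_subset_if_min_generators_eq[OF A.comm_group_axioms fA assms(1) l DA _ _ n(2)])
        (use assms(4) A.nat_pow_closed[OF z(1), of n] in simp_all)
    with n(1) show ?thesis by blast
  qed
  \<comment> \<open>Any nonlinear degree may serve as \<open>m\<close>, since its square is the
    index of the center.\<close>
  obtain m \<tau> where m: "irreducible_rep G m \<tau>" "m \<noteq> 1" using VZ_nonlinear_exists[OF VZ] by blast
  have mm: "m\<^sup>2 * card ?Z = order G" by (rule VZ_nonlinear_degree[OF VZ m])
  have m0: "0 < m" using m(1) by (simp add: irreducible_rep_def complex_rep_def)
  have typesG: "if \<forall>d\<in>?D. \<sigma> d = 1\<^sub>m k then k = 1 else k = m" if irr: "irreducible_rep G k \<sigma>" for k \<sigma>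
  proof (cases "k = 1")
    case True
    then show ?thesis using rep_degree_1_derived[OF G] irr by (simp add: irreducible_rep_def)
  next
    case False
    have "k\<^sup>2 = m\<^sup>2" using VZ_nonlinear_degree[OF VZ irr False] mm cZ by (metis mult_right_cancel)
    then show ?thesis using irreducible_rep_derived_trivial[OF G irr] False by auto
  qed
  \<comment> \<open>In an abelian group both cases have degree 1; the statement is shaped to match
    the decomposition with \<open>w = 1\<close>.\<close>
  have typesA: "if \<forall>d\<in>?D. \<sigma> d = 1\<^sub>m k then k = 1 else k = 1" if irr: "irreducible_rep ?A k \<sigma>" for k \<sigma>
  proof -
    have "0 < k" using irr by (simp add: irreducible_rep_def complex_rep_def)
    then have "k = 1"
      by (rule irreducible_rep_scalars_degree_1[OF irr]) (use central_scalar[OF A irr] A.m_comm in blast)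
    then show ?thesis by simp
  qed
  have ge: "m * min_quasi_perm_degree ?A \<le> min_quasi_perm_degree G"
  proof -
    obtain \<rho> where \<rho>: "complex_rep G (min_quasi_perm_degree G) \<rho>" "inj_on \<rho> (carrier G)"
      "\<And>g. g \<in> carrier G \<Longrightarrow> trace_mat (\<rho> g) \<in> \<nat>"
      using min_quasi_perm_degree_attained[OF G fin] by blast
    obtain Ls Ms where
      Ls: "\<And>\<phi>. \<phi> \<in> set Ls \<Longrightarrow> lin_char ?A \<phi> \<and> (\<exists>d\<in>?D. \<phi> d \<noteq> 1)" and
      Ms: "\<And>\<mu>. \<mu> \<in> set Ms \<Longrightarrow> lin_char ?A \<mu> \<and> (\<forall>d\<in>?D. \<mu> d = 1)" and
      tr: "\<And>z. z \<in> ?Z \<Longrightarrow> trace_mat (\<rho> z) = of_nat m * (\<Sum>\<phi>\<leftarrow>Ls. \<phi> z) + (\<Sum>\<mu>\<leftarrow>Ms. \<mu> z)" and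
      ker: "\<And>z. z \<in> ?Z \<Longrightarrow> \<forall>\<phi>\<in>set Ls \<union> set Ms. \<phi> z = 1 \<Longrightarrow> \<rho> z = 1\<^sub>m (min_quasi_perm_degree G)" and
      deg: "min_quasi_perm_degree G = m * length Ls + length Ms"
      by (rule central_decomposition[OF G fin \<rho>(1) Z.subset Z.one_closed DZ group_center_comm typesG], assumption+, rule that)
    have faith: "z = \<one>\<^bsub>?A\<^esub>"
      if "z \<in> carrier ?A" "\<forall>\<phi>\<in>set Ls \<union> set Ms. \<phi> z = 1" for z
    proof -
      have z: "z \<in> ?Z" using that(1) by simp
      have "\<rho> z = \<rho> \<one>\<^bsub>G\<^esub>" using ker[OF z] that(2) complex_repD(3)[OF G \<rho>(1)] by simp
      then show ?thesis using \<rho>(2) z Z.mem_carrier by (simp add: inj_on_def)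
    qed
    have nat: "of_nat m * (\<Sum>\<phi>\<leftarrow>Ls. \<phi> z) + (\<Sum>\<mu>\<leftarrow>Ms. \<mu> z) \<in> \<nat>" if "z \<in> carrier ?A" for z
      using that tr[of z] \<rho>(3)[OF Z.mem_carrier[of z]] by simp
    have split: "Ls \<noteq> []"
      "\<And>z. z \<in> carrier ?A \<Longrightarrow> \<exists>t::int. (\<Sum>\<phi>\<leftarrow>Ls. \<phi> z) = of_int t \<and> 0 \<le> int m * t + int (length Ms)"
      "\<And>z. z \<in> carrier ?A \<Longrightarrow> (\<Sum>\<phi>\<leftarrow>Ls. \<phi> z) = of_nat (length Ls) \<Longrightarrow> z = \<one>\<^bsub>?A\<^esub>"
      by (rule character_split[OF A fA DA Dne Dpow m0 Ls Ms faith nat]; assumption)+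
    \<comment> \<open>The most trivial summands compatible with
      \<open>m * (length Ls + r) \<le> m * length Ls + length Ms\<close>. Rounding down is harmless
      because the sum over \<open>Ls\<close> is an integer.\<close>
    define r where "r = length Ms div m"
    have 1: "complex_rep ?A 1 (\<lambda>g. mat 1 1 (\<lambda>_. \<phi> g))" if "\<phi> \<in> set Ls" for \<phi>
      unfolding complex_rep_iff[OF A] using lin_charD[of ?A \<phi>] Ls[OF that]
      by (auto simp: scalar_prod_def intro!: eq_matI)
    obtain \<sigma> where \<sigma>: "complex_rep ?A (1 * length Ls + r) \<sigma>"
      "\<And>z. z \<in> carrier ?A \<Longrightarrow> trace_mat (\<sigma> z) = (\<Sum>\<phi>\<leftarrow>Ls. trace_mat (mat 1 1 (\<lambda>_. \<phi> z))) + of_nat r"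
      by (rule padded_direct_sum[OF A split(1), where k = 1 and f = "\<lambda>\<phi> g. mat 1 1 (\<lambda>_. \<phi> g)" and r = r])
        (erule 1, rule that)
    have \<sigma>tr: "trace_mat (\<sigma> z) = (\<Sum>\<phi>\<leftarrow>Ls. \<phi> z) + of_nat r" if "z \<in> carrier ?A" for z
      using \<sigma>(2)[OF that] by (simp add: trace_mat_def)
    have "min_quasi_perm_degree ?A \<le> 1 * length Ls + r"
    proof (rule min_quasi_perm_degree_le[OF A \<sigma>(1)])
      fix z assume z: "z \<in> carrier ?A"
      obtain t where t: "(\<Sum>\<phi>\<leftarrow>Ls. \<phi> z) = of_int t" "0 \<le> int m * t + int (length Ms)"
        using split(2)[OF z] by blast
      \<comment> \<open>Writing -t as a quotient by m lets monotonicity of \<open>div\<close> turn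
        the bound on -t m into -t \<le> r.\<close>
      have "- t = - t * int m div int m"
        using m0 by (intro nonzero_mult_div_cancel_right[symmetric]) simp
      also have "\<dots> \<le> int (length Ms) div int m"
        by (rule zdiv_mono1) (use t(2) m0 in \<open>simp_all add: mult.commute\<close>)
      finally have "- t \<le> int (length Ms) div int m" .
      then have "0 \<le> t + int r" by (simp add: r_def zdiv_int)
      then have "of_int (t + int r) \<in> (\<nat> :: complex set)" by (rule of_int_in_Nats)
      then show "trace_mat (\<sigma> z) \<in> \<nat>" using \<sigma>tr[OF z] t(1) by simp
    next
      fix z assume z: "z \<in> carrier ?A" "trace_mat (\<sigma> z) = of_nat (1 * length Ls + r)"
      then show "z = \<one>\<^bsub>?A\<^esub>" using split(3)[OF z(1)] \<sigma>tr[OF z(1)] by simp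
    qed
    then have "m * min_quasi_perm_degree ?A \<le> m * (length Ls + r)" by simp
    also have "\<dots> \<le> m * length Ls + length Ms" by (simp add: r_def algebra_simps)
    finally show ?thesis using deg by simp
  qed
  have le: "min_quasi_perm_degree G \<le> m * min_quasi_perm_degree ?A"
  proof -
    obtain \<rho> where \<rho>: "complex_rep ?A (min_quasi_perm_degree ?A) \<rho>" "inj_on \<rho> (carrier ?A)"
      "\<And>g. g \<in> carrier ?A \<Longrightarrow> trace_mat (\<rho> g) \<in> \<nat>"
      using min_quasi_perm_degree_attained[OF A fA] by blast
    \<comment> \<open>Here the central subset is the whole carrier, so the carrier update in the
      decomposition has to be collapsed.\<close>
    have u: "?A\<lparr>carrier := carrier ?A\<rparr> = ?A" by simp
    have DA': "?D \<subseteq> carrier ?A" using DZ by simp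
    obtain Ls Ms where
      Ls: "\<And>\<phi>. \<phi> \<in> set Ls \<Longrightarrow> lin_char ?A \<phi> \<and> (\<exists>d\<in>?D. \<phi> d \<noteq> 1)" and
      Ms: "\<And>\<mu>. \<mu> \<in> set Ms \<Longrightarrow> lin_char ?A \<mu> \<and> (\<forall>d\<in>?D. \<mu> d = 1)" and
      tr: "\<And>z. z \<in> carrier ?A \<Longrightarrow> trace_mat (\<rho> z) = of_nat 1 * (\<Sum>\<phi>\<leftarrow>Ls. \<phi> z) + (\<Sum>\<mu>\<leftarrow>Ms. \<mu> z)" and
      ker: "\<And>z. z \<in> carrier ?A \<Longrightarrow> \<forall>\<phi>\<in>set Ls \<union> set Ms. \<phi> z = 1 \<Longrightarrow> \<rho> z = 1\<^sub>m (min_quasi_perm_degree ?A)" and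
      deg: "min_quasi_perm_degree ?A = 1 * length Ls + length Ms"
      by (rule central_decomposition[OF A fA \<rho>(1) subset_refl A.one_closed DA' A.m_comm typesA, unfolded u], assumption+, rule that)
    have faith: "z = \<one>\<^bsub>?A\<^esub>"
      if "z \<in> carrier ?A" "\<forall>\<phi>\<in>set Ls \<union> set Ms. \<phi> z = 1" for z
    proof -
      have "\<rho> z = \<rho> \<one>\<^bsub>?A\<^esub>" using ker[OF that(1)] that(2) complex_repD(3)[OF A \<rho>(1)] by simp
      then show ?thesis using \<rho>(2) that(1) A.one_closed unfolding inj_on_def by blast
    qed
    have nat: "of_nat 1 * (\<Sum>\<phi>\<leftarrow>Ls. \<phi> z) + (\<Sum>\<mu>\<leftarrow>Ms. \<mu> z) \<in> \<nat>" if "z \<in> carrier ?A" for z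
      using tr[OF that] \<rho>(3)[OF that] by simp
    have w: "0 < (1::nat)" by simp
    have split: "Ls \<noteq> []"
      "\<And>z. z \<in> carrier ?A \<Longrightarrow> \<exists>t::int. (\<Sum>\<phi>\<leftarrow>Ls. \<phi> z) = of_int t \<and> 0 \<le> int 1 * t + int (length Ms)"
      "\<And>z. z \<in> carrier ?A \<Longrightarrow> (\<Sum>\<phi>\<leftarrow>Ls. \<phi> z) = of_nat (length Ls) \<Longrightarrow> z = \<one>\<^bsub>?A\<^esub>"
      by (rule character_split[OF A fA DA Dne Dpow w Ls Ms faith nat]; assumption)+
    have "\<exists>\<sigma>. complex_rep G m \<sigma> \<and> (\<forall>g \<in> carrier G. trace_mat (\<sigma> g) = (if g \<in> ?Z then of_nat m * \<phi> g else 0))"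
      if \<phi>: "\<phi> \<in> set Ls" for \<phi>
    proof -
      obtain d where "lin_char ?A \<phi>" "d \<in> ?D" "\<phi> d \<noteq> 1" using Ls[OF \<phi>] by blast
      from VZ_lift_exists[OF VZ this mm] show ?thesis by metis
    qed
    then obtain f where f: "\<And>\<phi>. \<phi> \<in> set Ls \<Longrightarrow> complex_rep G m (f \<phi>)"
      "\<And>\<phi> g. \<phi> \<in> set Ls \<Longrightarrow> g \<in> carrier G \<Longrightarrow> trace_mat (f \<phi> g) = (if g \<in> ?Z then of_nat m * \<phi> g else 0)"
      by metis
    \<comment> \<open>On the center the new trace becomes m times (t + \<open>length Ms\<close>),
      which the lower bound on t makes a natural number.\<close>
    define r where "r = m * length Ms"
    obtain \<sigma> where \<sigma>: "complex_rep G (m * length Ls + r) \<sigma>"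
      "\<And>g. g \<in> carrier G \<Longrightarrow> trace_mat (\<sigma> g) = (\<Sum>\<phi>\<leftarrow>Ls. trace_mat (f \<phi> g)) + of_nat r"
      by (rule padded_direct_sum[OF G split(1), where k = m and f = f and r = r]) (erule f(1), rule that)
    have on: "trace_mat (\<sigma> g) = of_nat m * (\<Sum>\<phi>\<leftarrow>Ls. \<phi> g) + of_nat r" if g: "g \<in> ?Z" for g
    proof -
      have "(\<Sum>\<phi>\<leftarrow>Ls. trace_mat (f \<phi> g)) = (\<Sum>\<phi>\<leftarrow>Ls. of_nat m * \<phi> g)"
        using f(2) g Z.mem_carrier by (intro arg_cong[of _ _ sum_list] map_cong refl) simp
      then show ?thesis using \<sigma>(2)[of g] g Z.mem_carrier by (simp add: sum_list_const_mult)
    qed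
    \<comment> \<open>The lifted characters vanish off the center, leaving only the trivial
      summands.\<close>
    have off: "trace_mat (\<sigma> g) = of_nat r" if g: "g \<in> carrier G" "g \<notin> ?Z" for g
    proof -
      have "(\<Sum>\<phi>\<leftarrow>Ls. trace_mat (f \<phi> g)) = (\<Sum>\<phi>\<leftarrow>Ls. 0)"
        using f(2) g by (intro arg_cong[of _ _ sum_list] map_cong refl) simp
      then show ?thesis using \<sigma>(2)[of g] g by simp
    qed
    have "min_quasi_perm_degree G \<le> m * length Ls + r"
    proof (rule min_quasi_perm_degree_le[OF G \<sigma>(1)])
      fix g assume g: "g \<in> carrier G"
      show "trace_mat (\<sigma> g) \<in> \<nat>"
      proof (cases "g \<in> ?Z")
        case True
        then obtain t where t: "(\<Sum>\<phi>\<leftarrow>Ls. \<phi> g) = of_int t" "0 \<le> int 1 * t + int (length Ms)"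
          using split(2)[of g] by auto
        have "0 \<le> int m * (t + int (length Ms))" using t(2) by simp
        then have "of_int (int m * (t + int (length Ms))) \<in> (\<nat> :: complex set)" by (rule of_int_in_Nats)
        then show ?thesis using on[OF True] t(1) by (simp add: r_def algebra_simps)
      qed (use off g in simp)
      assume eq: "trace_mat (\<sigma> g) = of_nat (m * length Ls + r)"
      \<comment> \<open>Off the center the trace is \<open>r\<close>, strictly below the degree
        because \<open>m\<close> is positive and \<open>Ls\<close> is nonempty.\<close>
      have "g \<in> ?Z"
      proof (rule ccontr)
        assume "g \<notin> ?Z"
        then show False using off[OF g] eq m0 split(1) by simp
      qed
      moreover from this have "(\<Sum>\<phi>\<leftarrow>Ls. \<phi> g) = of_nat (length Ls)" using on eq m0 by simp
      ultimately show "g = \<one>\<^bsub>G\<^esub>" using split(3)[of g] by simp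
    qed
    also have "\<dots> = m * min_quasi_perm_degree ?A" unfolding deg by (simp add: r_def algebra_simps)
    finally show ?thesis .
  qed
  have "order (G Mod ?Z) * card ?Z = order G"
    using lagrange[OF Z.subgroup_axioms] by (simp add: Coset.order_def FactGroup_def)
  then have "order (G Mod ?Z) = m\<^sup>2" using mm cZ by (metis mult_right_cancel)
  then have "sqrt (real (order (G Mod ?Z))) = real m" by simp
  moreover have "min_quasi_perm_degree G = m * min_quasi_perm_degree ?A" using ge le by simp
  ultimately show ?thesis by simp
qed

end
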